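(* Let $\mathbf q=(q_2,q_3,\ldots)$ be indeterminates. In $\mathbb{Q}S_n[[\mathbf q]]$, $$\Big(\sum_{\sigma\in S_n}\mathbf q^{\beta(\sigma)}\sigma\Big)^{-1}=\sum_{f\in\mathcal P_n}\Pi(f)(-1)^{\ell(f)}\mathbf q^{\beta(f)}=\sum_{f\in\mathcal I_n}\Pi(f)(-1)^{\ell(f)}\mathbf q^{\beta(f)}.$$ Moreover, the rightmost identity continues to hold if $\mathcal P_n$ and $\mathcal I_n$ are both restricted to the transitive factorizations of any fixed genus $g$.
   Context: Permutations are multiplied right to left. A factorization in $S_n$ is a tuple $f=(\sigma_1,\ldots,\sigma_r)$ of elements of $S_n$; $\ell(f)=r$, and $\Pi(f)=\sigma_1\cdots\sigma_r$ is its target (the empty factorization has length 0 and target the identity). The signature $\beta(f)=(\beta_2,\beta_3,\ldots)$ records in $\beta_j$ the total number of disjoint cycles of length $j$ among all factors; $\beta(\sigma)$ is the signature of a single permutation, and $\mathbf q^\beta=\prod_j q_j^{\beta_j}$. The depth is $\sum_j(j-1)\beta_j$; a factorization is transitive if its factors generate a transitive subgroup, and then its genus is the $g\ge0$ with depth $=n+\ell(\Pi(f))-2+2g$, $\ell(\cdot)$ of a permutation being its number of cycles. $\mathcal P_n$ is the set of proper factorizations in $S_n$ (no factor equal to the identity), including the empty one. A cycle factorization is one whose factors are all nontrivial cycles; two are equivalent if one is obtained from the other by repeatedly interchanging adjacent disjoint factors; $\mathcal I_n$ is the set of equivalence classes (inequivalent factorizations), including the empty one, with $\ell$, $\Pi$,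 $\beta$, transitivity and genus defined on classes. *)

theory Defs
  imports Complex_Main "HOL-Library.Multiset" "HOL-Combinatorics.Orbits" "HOL-Algebra.Ring"
    "HOL-Algebra.Sym_Groups"
begin

section \<open>The group algebra over the rationals\<close>

text \<open>Elements are functions \<open>'g \<Rightarrow> rat\<close> of finite support contained in the carrier of
  the group; the product is convolution.\<close>

definition group_algebra :: "('g, 'm) monoid_scheme \<Rightarrow> ('g \<Rightarrow> rat) ring" where
  "group_algebra G =
     \<lparr> carrier = {x. finite {g. x g \<noteq> 0} \<and> {g. x g \<noteq> 0} \<subseteq> carrier G},
       mult = (\<lambda>x y g. \<Sum>(h, k) \<in> {(h, k). x h \<noteq> 0 \<and> y k \<noteq> 0 \<and> h \<otimes>\<^bsub>G\<^esub> k = g}. x h * y k),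
       one = (\<lambda>g. if g = \<one>\<^bsub>G\<^esub> then 1 else 0),
       zero = (\<lambda>g. 0),
       add = (\<lambda>x y g. x g + y g) \<rparr>"

text \<open>\<open>scaled_elem c \<sigma>\<close> is the element \<open>c \<sigma>\<close> of the group algebra.\<close>

definition scaled_elem :: "rat \<Rightarrow> 'g \<Rightarrow> 'g \<Rightarrow> rat" where
  "scaled_elem c \<sigma> = (\<lambda>g. if g = \<sigma> then c else 0)"


section \<open>Formal power series in a set of commuting indeterminates\<close>

text \<open>\<open>mpower_series R X\<close> is the ring \<open>R[[q\<^sub>x : x \<in> X]]\<close>; the indeterminates commute
  with each other and with the (possibly noncommuting) coefficients. The monomial with
  exponents \<open>\<beta>\<close> is encoded by the finite multiset over \<open>X\<close> in which \<open>x\<close> has multiplicity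
  \<open>\<beta>\<^sub>x\<close>, and a series is its coefficient function on monomials.\<close>

definition mpower_series :: "('a, 'm) ring_scheme \<Rightarrow> 'x set \<Rightarrow> ('x multiset \<Rightarrow> 'a) ring" where
  "mpower_series R X =
     \<lparr> carrier = {F. (\<forall>b. F b \<in> carrier R) \<and> (\<forall>b. \<not> set_mset b \<subseteq> X \<longrightarrow> F b = \<zero>\<^bsub>R\<^esub>)},
       mult = (\<lambda>F G b. \<Oplus>\<^bsub>R\<^esub>p \<in> {(c, d). c + d = b}. F (fst p) \<otimes>\<^bsub>R\<^esub> G (snd p)),
       one = (\<lambda>b. if b = {#} then \<one>\<^bsub>R\<^esub> else \<zero>\<^bsub>R\<^esub>),
       zero = (\<lambda>b. \<zero>\<^bsub>R\<^esub>),
       add = (\<lambda>F G b. F b \<oplus>\<^bsub>R\<^esub> G b) \<rparr>"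

text \<open>\<open>monomial R a b\<close> is the series \<open>a q\<^sup>b\<close>.\<close>

definition monomial :: "('a, 'm) ring_scheme \<Rightarrow> 'a \<Rightarrow> 'x multiset \<Rightarrow> ('x multiset \<Rightarrow> 'a)" where
  "monomial R a b = (\<lambda>b'. if b' = b then a else \<zero>\<^bsub>R\<^esub>)"

text \<open>A family of series is summable if every monomial has a nonzero coefficient in only
  finitely many members; its sum is then taken coefficientwise.\<close>

definition summable_family ::
  "('a, 'm) ring_scheme \<Rightarrow> ('i \<Rightarrow> 'x multiset \<Rightarrow> 'a) \<Rightarrow> 'i set \<Rightarrow> bool" where
  "summable_family R F I \<longleftrightarrow> (\<forall>b. finite {i \<in> I. F i b \<noteq> \<zero>\<^bsub>R\<^esub>})"

definition series_sum ::
  "('a, 'm) ring_scheme \<Rightarrow> ('i \<Rightarrow> 'x multiset \<Rightarrow> 'a) \<Rightarrow> 'i set \<Rightarrow> ('x multiset \<Rightarrow> 'a)" where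
  "series_sum R F I = (\<lambda>b. \<Oplus>\<^bsub>R\<^esub>i \<in> {i \<in> I. F i b \<noteq> \<zero>\<^bsub>R\<^esub>}. F i b)"


section \<open>Factorizations\<close>

type_synonym factorization = "(nat \<Rightarrow> nat) list"

text \<open>The disjoint cycles of \<open>\<sigma> \<in> S\<^sub>n\<close> are represented by their supports; fixed points
  count as cycles of length 1.\<close>

definition cycles_of :: "nat \<Rightarrow> (nat \<Rightarrow> nat) \<Rightarrow> nat set set" where
  "cycles_of n \<sigma> = orbit \<sigma> ` {1..n}"

text \<open>A signature \<open>(\<beta>\<^sub>2, \<beta>\<^sub>3, \<dots>)\<close> is the multiset in which \<open>j \<ge> 2\<close> has multiplicity \<open>\<beta>\<^sub>j\<close>.\<close>

definition perm_signature :: "nat \<Rightarrow> (nat \<Rightarrow> nat) \<Rightarrow> nat multiset" where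
  "perm_signature n \<sigma> = {# j \<in># image_mset card (mset_set (cycles_of n \<sigma>)). j \<ge> 2 #}"

definition signature :: "nat \<Rightarrow> factorization \<Rightarrow> nat multiset" where
  "signature n f = (\<Sum>\<sigma> \<leftarrow> f. perm_signature n \<sigma>)"

definition target :: "factorization \<Rightarrow> nat \<Rightarrow> nat" where
  "target f = foldr (\<circ>) f id"

definition depth :: "nat \<Rightarrow> factorization \<Rightarrow> nat" where
  "depth n f = (\<Sum>j \<in># signature n f. j - 1)"

definition transitive :: "nat \<Rightarrow> factorization \<Rightarrow> bool" where
  "transitive n f \<longleftrightarrow>
     (\<forall>x \<in> {1..n}. \<forall>y \<in> {1..n}. \<exists>p \<in> generate (sym_group n) (set f). p x = y)"

definition transitive_of_genus :: "nat \<Rightarrow> nat \<Rightarrow> factorization \<Rightarrow> bool" where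
  "transitive_of_genus n g f \<longleftrightarrow>
     transitive n f \<and>
     int (depth n f) = int n + int (card (cycles_of n (target f))) - 2 + 2 * int g"

definition proper_factorizations :: "nat \<Rightarrow> factorization set" where
  "proper_factorizations n = {f. set f \<subseteq> carrier (sym_group n) - {id}}"

definition nontrivial_cycles :: "nat \<Rightarrow> (nat \<Rightarrow> nat) set" where
  "nontrivial_cycles n =
     {cycle_of_list cs | cs. cycle cs \<and> length cs \<ge> 2 \<and> set cs \<subseteq> {1..n}}"

definition cycle_factorizations :: "nat \<Rightarrow> factorization set" where
  "cycle_factorizations n = {f. set f \<subseteq> nontrivial_cycles n}"

definition disjoint_perms :: "(nat \<Rightarrow> nat) \<Rightarrow> (nat \<Rightarrow> nat) \<Rightarrow> bool" where
  "disjoint_perms \<sigma> \<tau> \<longleftrightarrow> (\<forall>x. \<sigma> x = x \<or> \<tau> x = x)"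

inductive swap_step :: "factorization \<Rightarrow> factorization \<Rightarrow> bool" where
  "disjoint_perms \<sigma> \<tau> \<Longrightarrow> swap_step (u @ [\<sigma>, \<tau>] @ v) (u @ [\<tau>, \<sigma>] @ v)"

definition swap_equiv :: "nat \<Rightarrow> (factorization \<times> factorization) set" where
  "swap_equiv n =
     {(f, f'). f \<in> cycle_factorizations n \<and> f' \<in> cycle_factorizations n \<and> swap_step\<^sup>*\<^sup>* f f'}"

definition inequivalent_factorizations :: "nat \<Rightarrow> factorization set set" where
  "inequivalent_factorizations n = cycle_factorizations n // swap_equiv n"

text \<open>The common value of a function on the members of an equivalence class. The functions
  used below are constant on classes, see \<open>on_class_eq\<close> and the facts preceding it.\<close>

definition on_class :: "('f \<Rightarrow> 'v) \<Rightarrow> 'f set \<Rightarrow> 'v" where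
  "on_class \<phi> C = the_elem (\<phi> ` C)"

lemma disjoint_perms_commute:
  assumes "\<sigma> permutes {1..n}" "\<tau> permutes {1..n}" "disjoint_perms \<sigma> \<tau>"
  shows "\<sigma> \<circ> \<tau> = \<tau> \<circ> \<sigma>"
proof
  fix x
  have inj: "\<sigma> y = \<sigma> z \<longleftrightarrow> y = z" "\<tau> y = \<tau> z \<longleftrightarrow> y = z" for y z
    using assms(1,2) by (auto dest: permutes_inj injD)
  consider "\<sigma> x = x" | "\<tau> x = x" using assms(3) by (auto simp: disjoint_perms_def)
  then show "(\<sigma> \<circ> \<tau>) x = (\<tau> \<circ> \<sigma>) x"
  proof cases
    case 1
    have "\<sigma> (\<tau> x) = \<tau> x"
      using assms(3)[unfolded disjoint_perms_def, rule_format, of "\<tau> x"] inj(2) 1 by metis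
    with 1 show ?thesis by simp
  next
    case 2
    have "\<tau> (\<sigma> x) = \<sigma> x"
      using assms(3)[unfolded disjoint_perms_def, rule_format, of "\<sigma> x"] inj(1) 2 by metis
    with 2 show ?thesis by simp
  qed
qed

lemma nontrivial_cycles_permute:
  assumes "\<sigma> \<in> nontrivial_cycles n" shows "\<sigma> permutes {1..n}"
  using assms unfolding nontrivial_cycles_def
  using permutes_subset[OF cycle_permutes] by blast

lemma swap_equiv_equiv: "equiv (cycle_factorizations n) (swap_equiv n)"
proof (rule equivI)
  have "symp swap_step"
  proof (rule sympI)
    fix f f' assume "swap_step f f'"
    then show "swap_step f' f"
    proof cases
      case (1 \<sigma> \<tau> u v)
      then have "disjoint_perms \<tau> \<sigma>" by (auto simp: disjoint_perms_def)
      then show ?thesis unfolding 1 by (rule swap_step.intros)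
    qed
  qed
  then have "symp swap_step\<^sup>*\<^sup>*" by (rule symp_rtranclp)
  from sympD[OF this] show "sym (swap_equiv n)"
    unfolding swap_equiv_def sym_def by auto
  show "refl_on (cycle_factorizations n) (swap_equiv n)"
    by (auto simp: refl_on_def swap_equiv_def)
  show "trans (swap_equiv n)"
    by (auto simp: trans_def swap_equiv_def intro: rtranclp_trans)
  show "swap_equiv n \<subseteq> cycle_factorizations n \<times> cycle_factorizations n"
    by (auto simp: swap_equiv_def)
qed

lemma swap_step_invariant:
  assumes "swap_step f f'" "f \<in> cycle_factorizations n"
  shows "f' \<in> cycle_factorizations n" "mset f' = mset f" "target f' = target f"
proof -
  from assms(1) obtain \<sigma> \<tau> u v where *: "disjoint_perms \<sigma> \<tau>"
    "f = u @ [\<sigma>, \<tau>] @ v" "f' = u @ [\<tau>, \<sigma>] @ v"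
    by (cases rule: swap_step.cases) auto
  show "f' \<in> cycle_factorizations n" "mset f' = mset f"
    using assms(2) * by (auto simp: cycle_factorizations_def)
  have "\<sigma> \<in> nontrivial_cycles n" "\<tau> \<in> nontrivial_cycles n"
    using assms(2) * by (auto simp: cycle_factorizations_def)
  then have "\<sigma> \<circ> \<tau> = \<tau> \<circ> \<sigma>"
    using disjoint_perms_commute[OF _ _ *(1)] nontrivial_cycles_permute by blast
  then show "target f' = target f"
    unfolding target_def * by (simp add: comp_assoc[symmetric])
qed

lemma swap_equiv_invariant:
  assumes "(f, f') \<in> swap_equiv n"
  shows "length f' = length f" "target f' = target f" "signature n f' = signature n f"
    "transitive_of_genus n g f' = transitive_of_genus n g f"
proof -
  have "swap_step\<^sup>*\<^sup>* f f'" "f \<in> cycle_factorizations n"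
    using assms by (auto simp: swap_equiv_def)
  then have *: "f' \<in> cycle_factorizations n \<and> mset f' = mset f \<and> target f' = target f"
    by (induction rule: rtranclp_induct) (use swap_step_invariant in auto)
  then show "length f' = length f" "target f' = target f" by (auto dest: mset_eq_length)
  show sig: "signature n f' = signature n f"
  proof -
    have "mset (map (perm_signature n) f') = mset (map (perm_signature n) f)"
      using * by simp
    then show ?thesis unfolding signature_def by (metis sum_mset_sum_list)
  qed
  have "set f' = set f" using * by (auto dest: mset_eq_setD)
  then show "transitive_of_genus n g f' = transitive_of_genus n g f"
    using * by (simp add: transitive_of_genus_def transitive_def depth_def sig)
qed

lemma on_class_eq:
  assumes "f \<in> cycle_factorizations n"
    and "\<And>f'. (f, f') \<in> swap_equiv n \<Longrightarrow> \<phi> f' = \<phi> f"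
  shows "on_class \<phi> (swap_equiv n `` {f}) = \<phi> f"
proof -
  have "f \<in> swap_equiv n `` {f}"
    using assms(1) equiv_class_self[OF swap_equiv_equiv] by blast
  then have "\<phi> ` (swap_equiv n `` {f}) = {\<phi> f}"
    using assms(2) by (intro equalityI subsetI) blast+
  then show ?thesis by (simp add: on_class_def)
qed


section \<open>The series in the statement\<close>

text \<open>The ring \<open>\<rat>S\<^sub>n[[q\<^sub>2, q\<^sub>3, \<dots>]]\<close>.\<close>

abbreviation QSq :: "nat \<Rightarrow> (nat multiset \<Rightarrow> (nat \<Rightarrow> nat) \<Rightarrow> rat) ring" where
  "QSq n \<equiv> mpower_series (group_algebra (sym_group n)) {2..}"

definition perm_term :: "nat \<Rightarrow> (nat \<Rightarrow> nat) \<Rightarrow> (nat multiset \<Rightarrow> (nat \<Rightarrow> nat) \<Rightarrow> rat)" where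
  "perm_term n \<sigma> =
     monomial (group_algebra (sym_group n)) (scaled_elem 1 \<sigma>) (perm_signature n \<sigma>)"

definition proper_term :: "nat \<Rightarrow> factorization \<Rightarrow> (nat multiset \<Rightarrow> (nat \<Rightarrow> nat) \<Rightarrow> rat)" where
  "proper_term n f =
     monomial (group_algebra (sym_group n)) (scaled_elem ((-1) ^ length f) (target f))
       (signature n f)"

definition inequivalent_term ::
  "nat \<Rightarrow> factorization set \<Rightarrow> (nat multiset \<Rightarrow> (nat \<Rightarrow> nat) \<Rightarrow> rat)" where
  "inequivalent_term n C =
     monomial (group_algebra (sym_group n))
       (scaled_elem ((-1) ^ on_class length C) (on_class target C))
       (on_class (signature n) C)"

abbreviation proper_sum ::
  "nat \<Rightarrow> factorization set \<Rightarrow> (nat multiset \<Rightarrow> (nat \<Rightarrow> nat) \<Rightarrow> rat)" where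
  "proper_sum n P \<equiv> series_sum (group_algebra (sym_group n)) (proper_term n) P"

abbreviation inequivalent_sum ::
  "nat \<Rightarrow> factorization set set \<Rightarrow> (nat multiset \<Rightarrow> (nat \<Rightarrow> nat) \<Rightarrow> rat)" where
  "inequivalent_sum n I \<equiv> series_sum (group_algebra (sym_group n)) (inequivalent_term n) I"

end

theory Submission
  imports Defs
begin

text \<open>The first identity is the geometric series. The second one is Moebius inversion in the
  partially commutative monoid of cycles (Cartier and Foata): splitting every factor of a proper
  factorization into its disjoint cycles gives a class of cycle factorizations with the same
  signature, target and orbits, and the signs of all proper factorizations over a given class
  of length \<open>l\<close> add up to \<open>(-1)^l\<close>.\<close>

section \<open>Group algebras and power series over them\<close>

text \<open>A chain of interchanges from \<open>v @ u\<close> to \<open>v @ u'\<close> may mix the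
  letters of both blocks, so cancelling \<open>v\<close> is not a matter of inspecting the chain.
  Yet cancellation is what makes the rest of a word well defined once the cycles of a first factor
  are removed, and so lets the signed count proceed by induction on the length. The count is made
  over each class separately. A property that is constant on classes and preserved by refinement
  selects whole fibres, which yields the restriction to transitive factorizations of genus
  \<open>g\<close> from the same count. In the geometric series every proper factor adds at least
  one cycle to the signature, which leaves finitely many factorizations for each monomial. The
  coefficients do not commute, so the products on both sides are computed; uniqueness of the inverse
  is read off from the recursion for its coefficients.\<close>

lemma abelian_group_group_algebra: "abelian_group (group_algebra G)"
proof (rule abelian_groupI)
  fix x y assume "x \<in> carrier (group_algebra G)" "y \<in> carrier (group_algebra G)"
  then have fin: "finite ({g. x g \<noteq> 0} \<union> {g. y g \<noteq> 0})"
    and sub: "{g. x g \<noteq> 0} \<union> {g. y g \<noteq> 0} \<subseteq> carrier G"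
    by (auto simp: group_algebra_def)
  have "{g. x g + y g \<noteq> 0} \<subseteq> {g. x g \<noteq> 0} \<union> {g. y g \<noteq> 0}" by auto
  with fin sub show "x \<oplus>\<^bsub>group_algebra G\<^esub> y \<in> carrier (group_algebra G)"
    by (auto simp: group_algebra_def intro: finite_subset)
next
  fix x assume "x \<in> carrier (group_algebra G)"
  then show "\<exists>y\<in>carrier (group_algebra G). y \<oplus>\<^bsub>group_algebra G\<^esub> x = \<zero>\<^bsub>group_algebra G\<^esub>"
    by (intro bexI[of _ "\<lambda>g. - x g"]) (auto simp: group_algebra_def)
qed (auto simp: group_algebra_def algebra_simps)

lemma finsum_group_algebra:
  assumes "finite A" "f \<in> A \<rightarrow> carrier (group_algebra G)"
  shows "(\<Oplus>\<^bsub>group_algebra G\<^esub>i\<in>A. f i) g = (\<Sum>i\<in>A. f i g)"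
proof -
  interpret abelian_group "group_algebra G" by (rule abelian_group_group_algebra)
  show ?thesis
    using assms
  proof (induction A rule: finite_induct)
    case empty
    then show ?case by (simp only: finsum_empty sum.empty) (simp add: group_algebra_def)
  next
    case (insert a A)
    then show ?case by (simp add: Pi_iff) (simp add: group_algebra_def)
  qed
qed

lemma group_algebra_mult_closed:
  assumes "group G" "x \<in> carrier (group_algebra G)" "y \<in> carrier (group_algebra G)"
  shows "x \<otimes>\<^bsub>group_algebra G\<^esub> y \<in> carrier (group_algebra G)"
proof -
  interpret group G by fact
  let ?S = "(\<lambda>(h, k). h \<otimes>\<^bsub>G\<^esub> k) ` ({g. x g \<noteq> 0} \<times> {g. y g \<noteq> 0})"
  have "(x \<otimes>\<^bsub>group_algebra G\<^esub> y) g = 0" if "g \<notin> ?S" for g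
  proof -
    have "{(h, k). x h \<noteq> 0 \<and> y k \<noteq> 0 \<and> h \<otimes>\<^bsub>G\<^esub> k = g} = {}" using that by force
    then show ?thesis by (simp only: group_algebra_def monoid.simps sum.empty)
  qed
  then have "{g. (x \<otimes>\<^bsub>group_algebra G\<^esub> y) g \<noteq> 0} \<subseteq> ?S" by auto
  moreover have "finite ?S" "?S \<subseteq> carrier G"
    using assms(2,3) by (auto simp: group_algebra_def)
  ultimately have "finite {g. (x \<otimes>\<^bsub>group_algebra G\<^esub> y) g \<noteq> 0}"
    "{g. (x \<otimes>\<^bsub>group_algebra G\<^esub> y) g \<noteq> 0} \<subseteq> carrier G"
    by (blast intro: finite_subset)+
  then show ?thesis by (simp add: group_algebra_def)
qed

lemma group_algebra_one_mult:
  assumes "group G" "y \<in> carrier (group_algebra G)"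
  shows "\<one>\<^bsub>group_algebra G\<^esub> \<otimes>\<^bsub>group_algebra G\<^esub> y = y"
proof
  fix g
  interpret group G by fact
  have "{(h, k). (if h = \<one>\<^bsub>G\<^esub> then 1 else 0 :: rat) \<noteq> 0 \<and> y k \<noteq> 0 \<and> h \<otimes>\<^bsub>G\<^esub> k = g}
      = (if y g = 0 then {} else {(\<one>\<^bsub>G\<^esub>, g)})"
    using assms(2) by (auto simp: group_algebra_def split: if_splits)
  then show "(\<one>\<^bsub>group_algebra G\<^esub> \<otimes>\<^bsub>group_algebra G\<^esub> y) g = y g"
    by (simp add: group_algebra_def)
qed

text \<open>Summing over all pairs of group elements instead of the supports gives an index set
  independent of \<open>x\<close> and \<open>y\<close>, so that sums of such products can be
  regrouped.\<close>

lemma group_algebra_mult_finite: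
  assumes "finite (carrier G)" "x \<in> carrier (group_algebra G)" "y \<in> carrier (group_algebra G)"
  shows "(x \<otimes>\<^bsub>group_algebra G\<^esub> y) g
    = (\<Sum>(h, k) \<in> {(h, k) \<in> carrier G \<times> carrier G. h \<otimes>\<^bsub>G\<^esub> k = g}. x h * y k)"
proof -
  have "finite {(h, k) \<in> carrier G \<times> carrier G. h \<otimes>\<^bsub>G\<^esub> k = g}"
    by (rule finite_subset[of _ "carrier G \<times> carrier G"]) (use assms(1) in auto)
  then show ?thesis
    using assms(2,3) unfolding group_algebra_def
    by (simp, intro sum.mono_neutral_left) auto
qed

lemma scaled_elem_carrier: "t \<in> carrier G \<Longrightarrow> scaled_elem s t \<in> carrier (group_algebra G)"
  by (auto simp: group_algebra_def scaled_elem_def)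

lemma group_algebra_carrierI:
  "finite (carrier G) \<Longrightarrow> {g. x g \<noteq> 0} \<subseteq> carrier G \<Longrightarrow> x \<in> carrier (group_algebra G)"
  by (auto simp: group_algebra_def intro: finite_subset)

section \<open>Power series: finite sums and products\<close>

lemma abelian_monoid_mpower_series:
  assumes "abelian_monoid R"
  shows "abelian_monoid (mpower_series R X)"
proof -
  interpret abelian_monoid R by fact
  show ?thesis
    by (rule abelian_monoidI) (auto simp: mpower_series_def fun_eq_iff a_ac)
qed

lemma finsum_mpower_series:
  assumes "abelian_monoid R" "finite A" "F \<in> A \<rightarrow> carrier (mpower_series R X)"
  shows "(\<Oplus>\<^bsub>mpower_series R X\<^esub>i\<in>A. F i) b = (\<Oplus>\<^bsub>R\<^esub>i\<in>A. F i b)"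
proof -
  interpret R: abelian_monoid R by fact
  interpret S: abelian_monoid "mpower_series R X"
    by (rule abelian_monoid_mpower_series) fact
  show ?thesis
    using assms(2,3)
  proof (induction A rule: finite_induct)
    case empty
    then show ?case
      by (simp only: S.finsum_empty R.finsum_empty) (simp add: mpower_series_def)
  next
    case (insert a A)
    then have "(\<lambda>i. F i b) \<in> insert a A \<rightarrow> carrier R"
      by (auto simp: mpower_series_def)
    with insert show ?case by (simp add: Pi_iff) (simp add: mpower_series_def)
  qed
qed

text \<open>Makes Cauchy products finite sums: a submultiset of \<open>b\<close> is the
  \<open>mset\<close> of a list over the letters of \<open>b\<close> of length at most
  \<open>size b\<close>.\<close>

lemma finite_multiset_splits: "finite {(c, d). c + d = (b :: 'x multiset)}"
proof -
  have "finite {c. c \<subseteq># b}"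
  proof (rule finite_subset)
    show "{c. c \<subseteq># b} \<subseteq> mset ` {xs. set xs \<subseteq> set_mset b \<and> length xs \<le> size b}"
    proof
      fix c assume "c \<in> {c. c \<subseteq># b}"
      then have c: "c \<subseteq># b" by simp
      obtain xs where "mset xs = c" using ex_mset by blast
      with c show "c \<in> mset ` {xs. set xs \<subseteq> set_mset b \<and> length xs \<le> size b}"
        using set_mset_mono[OF c] size_mset_mono[OF c] by (intro image_eqI[of _ _ xs]) auto
    qed
  qed (simp add: finite_lists_length_le)
  then have "finite ({c. c \<subseteq># b} \<times> {c. c \<subseteq># b})" by simp
  then show ?thesis by (rule rev_finite_subset) auto
qed

text \<open>With constant coefficient 1 in the left factor, the coefficients of the right factor
  are determined recursively by those of the product; associativity plays no role.\<close>

lemma mpower_series_group_algebra_left_cancel: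
  fixes X :: "'x set" and G :: "('g, 'm) monoid_scheme"
  defines "S \<equiv> mpower_series (group_algebra G) X"
  assumes "group G" "F \<in> carrier S" "H \<in> carrier S" "H' \<in> carrier S"
    and one: "F {#} = \<one>\<^bsub>group_algebra G\<^esub>"
    and eq: "F \<otimes>\<^bsub>S\<^esub> H = F \<otimes>\<^bsub>S\<^esub> H'"
  shows "H = H'"
proof
  fix b
  let ?R = "group_algebra G"
  interpret abelian_group ?R by (rule abelian_group_group_algebra)
  have mem: "F c \<in> carrier ?R" "H c \<in> carrier ?R" "H' c \<in> carrier ?R" for c
    using assms(3-5) by (auto simp: S_def mpower_series_def)
  note closed = group_algebra_mult_closed[OF \<open>group G\<close>]
  show "H b = H' b"
  proof (induction b rule: measure_induct_rule[of size])
    case (less b)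
    let ?D = "{(c, d). c + d = b}"
    let ?rest = "?D - {({#}, b)}"
    have split: "(F \<otimes>\<^bsub>S\<^esub> K) b =
        K b \<oplus>\<^bsub>?R\<^esub> (\<Oplus>\<^bsub>?R\<^esub>p\<in>?rest. F (fst p) \<otimes>\<^bsub>?R\<^esub> K (snd p))"
      if K: "\<And>c. K c \<in> carrier ?R" for K
    proof -
      have "(F \<otimes>\<^bsub>S\<^esub> K) b
          = (\<Oplus>\<^bsub>?R\<^esub>p\<in>insert ({#}, b) ?rest. F (fst p) \<otimes>\<^bsub>?R\<^esub> K (snd p))"
        unfolding S_def mpower_series_def by (simp add: insert_absorb)
      also have "\<dots> = F {#} \<otimes>\<^bsub>?R\<^esub> K b
          \<oplus>\<^bsub>?R\<^esub> (\<Oplus>\<^bsub>?R\<^esub>p\<in>?rest. F (fst p) \<otimes>\<^bsub>?R\<^esub> K (snd p))"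
        by (subst finsum_insert) (auto intro: closed mem K finite_subset[OF _ finite_multiset_splits])
      finally show ?thesis using group_algebra_one_mult[OF \<open>group G\<close>] K one by simp
    qed
    have rest: "(\<Oplus>\<^bsub>?R\<^esub>p\<in>?rest. F (fst p) \<otimes>\<^bsub>?R\<^esub> H (snd p))
        = (\<Oplus>\<^bsub>?R\<^esub>p\<in>?rest. F (fst p) \<otimes>\<^bsub>?R\<^esub> H' (snd p))"
    proof (rule finsum_cong')
      fix p assume "p \<in> ?rest"
      \<comment> \<open>Outside \<open>({#}, b)\<close> the left component is nonempty, so the right
        one is strictly smaller and the induction hypothesis applies.\<close>
      then have "size (snd p) < size b" by (cases p) (auto simp: nonempty_has_size)
      then show "F (fst p) \<otimes>\<^bsub>?R\<^esub> H (snd p) = F (fst p) \<otimes>\<^bsub>?R\<^esub> H' (snd p)"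
        using less by simp
    qed (auto intro: closed mem)
    have "(\<Oplus>\<^bsub>?R\<^esub>p\<in>?rest. F (fst p) \<otimes>\<^bsub>?R\<^esub> H' (snd p)) \<in> carrier ?R"
      by (auto intro!: finsum_closed closed mem)
    moreover have "H b \<oplus>\<^bsub>?R\<^esub> (\<Oplus>\<^bsub>?R\<^esub>p\<in>?rest. F (fst p) \<otimes>\<^bsub>?R\<^esub> H' (snd p))
       = H' b \<oplus>\<^bsub>?R\<^esub> (\<Oplus>\<^bsub>?R\<^esub>p\<in>?rest. F (fst p) \<otimes>\<^bsub>?R\<^esub> H' (snd p))"
      using split[of H] split[of H'] mem eq rest by simp
    ultimately show ?case using mem by simp
  qed
qed

text \<open>One flat sum over a finite index set: the shape in which the product is later matched
  with a sum over factorizations grouped by signature and target.\<close>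

lemma mpower_series_mult_finite:
  fixes X :: "'x set" and G :: "('g, 'm) monoid_scheme"
  defines "S \<equiv> mpower_series (group_algebra G) X"
  assumes "group G" "finite (carrier G)" "F \<in> carrier S" "H \<in> carrier S"
  shows "(F \<otimes>\<^bsub>S\<^esub> H) b g
    = (\<Sum>((c, d), (h, k)) \<in> {(c, d). c + d = b} \<times> {(h, k) \<in> carrier G \<times> carrier G. h \<otimes>\<^bsub>G\<^esub> k = g}.
         F c h * H d k)"
proof -
  have mem: "F c \<in> carrier (group_algebra G)" "H c \<in> carrier (group_algebra G)" for c
    using assms(4,5) by (auto simp: S_def mpower_series_def)
  have "(F \<otimes>\<^bsub>S\<^esub> H) b g
      = (\<Oplus>\<^bsub>group_algebra G\<^esub>p\<in>{(c, d). c + d = b}. F (fst p) \<otimes>\<^bsub>group_algebra G\<^esub> H (snd p)) g"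
    by (simp add: S_def mpower_series_def)
  also have "\<dots> = (\<Sum>p\<in>{(c, d). c + d = b}. (F (fst p) \<otimes>\<^bsub>group_algebra G\<^esub> H (snd p)) g)"
    by (rule finsum_group_algebra)
      (auto intro: finite_multiset_splits group_algebra_mult_closed \<open>group G\<close> mem)
  also have "\<dots> = (\<Sum>p\<in>{(c, d). c + d = b}.
      \<Sum>q\<in>{(h, k) \<in> carrier G \<times> carrier G. h \<otimes>\<^bsub>G\<^esub> k = g}. F (fst p) (fst q) * H (snd p) (snd q))"
    by (intro sum.cong refl)
      (simp add: group_algebra_mult_finite[OF \<open>finite (carrier G)\<close> mem] case_prod_beta)
  also have "\<dots> = (\<Sum>(p, q) \<in> {(c, d). c + d = b} \<times> {(h, k) \<in> carrier G \<times> carrier G. h \<otimes>\<^bsub>G\<^esub> k = g}.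
      F (fst p) (fst q) * H (snd p) (snd q))"
    by (rule sum.cartesian_product)
  finally show ?thesis by (simp add: case_prod_beta)
qed

section \<open>Sums of monomials whose coefficients are scaled group elements\<close>

lemma monomial_scaled_elem_apply:
  "monomial (group_algebra G) (scaled_elem s t) m b g = (if m = b \<and> t = g then s else 0)"
  by (auto simp: monomial_def scaled_elem_def group_algebra_def)

lemma monomial_scaled_elem_nonzero:
  assumes "s \<noteq> 0"
  shows "monomial (group_algebra G) (scaled_elem s t) m b \<noteq> \<zero>\<^bsub>group_algebra G\<^esub> \<longleftrightarrow> m = b"
proof -
  have "scaled_elem s t \<noteq> (\<lambda>g. 0)" using assms by (metis scaled_elem_def)
  then show ?thesis by (auto simp: monomial_def group_algebra_def)
qed

text \<open>\<open>series_sum\<close> runs over the members that do not vanish at \<open>b\<close>.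
  Nonzero scalars, later signs, turn this condition into one on the exponent alone.\<close>

lemma monomial_scaled_elem_support:
  assumes "\<And>i. i \<in> I \<Longrightarrow> s i \<noteq> 0"
  shows "{i \<in> I. monomial (group_algebra G) (scaled_elem (s i) (t i)) (m i) b
      \<noteq> \<zero>\<^bsub>group_algebra G\<^esub>} = {i \<in> I. m i = b}"
  by (rule Collect_cong) (rule conj_cong[OF refl], rule monomial_scaled_elem_nonzero, rule assms)

lemma summable_family_monomials:
  assumes "\<And>i. i \<in> I \<Longrightarrow> s i \<noteq> 0" "\<And>b. finite {i \<in> I. m i = b}"
  shows "summable_family (group_algebra G)
    (\<lambda>i. monomial (group_algebra G) (scaled_elem (s i) (t i)) (m i)) I"
  unfolding summable_family_def using assms by (simp add: monomial_scaled_elem_support)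

lemma series_sum_monomials:
  assumes "\<And>i. i \<in> I \<Longrightarrow> s i \<noteq> 0" "\<And>b. finite {i \<in> I. m i = b}"
    "\<And>i. i \<in> I \<Longrightarrow> t i \<in> carrier G"
  shows "series_sum (group_algebra G)
      (\<lambda>i. monomial (group_algebra G) (scaled_elem (s i) (t i)) (m i)) I b g
    = (\<Sum>i \<in> {i \<in> I. m i = b \<and> t i = g}. s i)"
proof -
  let ?f = "\<lambda>i. monomial (group_algebra G) (scaled_elem (s i) (t i)) (m i)"
  have supp: "{i \<in> I. ?f i b \<noteq> \<zero>\<^bsub>group_algebra G\<^esub>} = {i \<in> I. m i = b}"
    by (rule monomial_scaled_elem_support) (rule assms(1))
  have "series_sum (group_algebra G) ?f I b g = (\<Sum>i \<in> {i \<in> I. m i = b}. ?f i b g)"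
    unfolding series_sum_def supp
    by (rule finsum_group_algebra) (auto simp: assms(2,3) monomial_def scaled_elem_carrier)
  also have "\<dots> = (\<Sum>i \<in> {i \<in> I. m i = b}. if t i = g then s i else 0)"
    by (intro sum.cong) (auto simp: monomial_scaled_elem_apply)
  also have "\<dots> = (\<Sum>i \<in> {i \<in> {i \<in> I. m i = b}. t i = g}. s i)"
    by (rule sum.inter_filter[symmetric]) (rule assms(2))
  also have "{i \<in> {i \<in> I. m i = b}. t i = g} = {i \<in> I. m i = b \<and> t i = g}" by auto
  finally show ?thesis .
qed

lemma finsum_monomials:
  assumes "finite I" "\<And>i. i \<in> I \<Longrightarrow> t i \<in> carrier G" "\<And>i. i \<in> I \<Longrightarrow> set_mset (m i) \<subseteq> X"
  defines "S \<equiv> mpower_series (group_algebra G) X"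
  shows "(\<Oplus>\<^bsub>S\<^esub>i\<in>I. monomial (group_algebra G) (scaled_elem (s i) (t i)) (m i)) \<in> carrier S"
    and "(\<Oplus>\<^bsub>S\<^esub>i\<in>I. monomial (group_algebra G) (scaled_elem (s i) (t i)) (m i)) b g
      = (\<Sum>i \<in> {i \<in> I. m i = b \<and> t i = g}. s i)"
proof -
  let ?f = "\<lambda>i. monomial (group_algebra G) (scaled_elem (s i) (t i)) (m i)"
  interpret R: abelian_group "group_algebra G" by (rule abelian_group_group_algebra)
  interpret S: abelian_monoid S
    unfolding S_def by (rule abelian_monoid_mpower_series) (rule R.abelian_monoid_axioms)
  have f: "?f \<in> I \<rightarrow> carrier S"
    using assms(2,3) by (auto simp: S_def mpower_series_def monomial_def scaled_elem_carrier)
  then show "(\<Oplus>\<^bsub>S\<^esub>i\<in>I. ?f i) \<in> carrier S" by (rule S.finsum_closed)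
  have "(\<Oplus>\<^bsub>S\<^esub>i\<in>I. ?f i) b g = (\<Oplus>\<^bsub>group_algebra G\<^esub>i\<in>I. ?f i b) g"
    unfolding S_def
    by (subst finsum_mpower_series[OF R.abelian_monoid_axioms \<open>finite I\<close> f[unfolded S_def]])
      (rule refl)
  also have "\<dots> = (\<Sum>i\<in>I. ?f i b g)"
    using f by (intro finsum_group_algebra[OF \<open>finite I\<close>]) (auto simp: S_def mpower_series_def Pi_iff)
  also have "\<dots> = (\<Sum>i \<in> {i \<in> I. m i = b \<and> t i = g}. s i)"
    unfolding monomial_scaled_elem_apply by (rule sum.inter_filter[symmetric]) fact
  finally show "(\<Oplus>\<^bsub>S\<^esub>i\<in>I. ?f i) b g = (\<Sum>i \<in> {i \<in> I. m i = b \<and> t i = g}. s i)" .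
qed

section \<open>Words up to interchanges of adjacent disjoint letters\<close>

lemma disjoint_perms_sym: "disjoint_perms a b \<longleftrightarrow> disjoint_perms b a"
  by (auto simp: disjoint_perms_def)

text \<open>The congruence of the partially commutative monoid, on arbitrary words;
  \<open>swap_equiv n\<close> is its restriction to words of nontrivial cycles.\<close>

abbreviation trace_eq :: "factorization \<Rightarrow> factorization \<Rightarrow> bool" where
  "trace_eq \<equiv> swap_step\<^sup>*\<^sup>*"

lemma trace_eq_sym: "trace_eq f f' \<Longrightarrow> trace_eq f' f"
proof (rule sympD[OF symp_rtranclp])
  show "symp swap_step"
  proof (rule sympI)
    fix f f' assume "swap_step f f'"
    then show "swap_step f' f"
      by cases (metis disjoint_perms_sym swap_step.intros)
  qed
qed

lemma trace_eq_append:
  assumes "trace_eq f f'"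
  shows "trace_eq (u @ f @ v) (u @ f' @ v)"
  using assms
proof (induction rule: rtranclp_induct)
  case (step f' f'')
  from step.hyps(2) have "swap_step (u @ f' @ v) (u @ f'' @ v)"
  proof cases
    case (1 \<sigma> \<tau> u' v')
    then show ?thesis using swap_step.intros[of \<sigma> \<tau> "u @ u'" "v' @ v"] by simp
  qed
  with step.IH show ?case by (rule rtranclp.rtrancl_into_rtrancl)
qed simp

lemma trace_eq_mset: "trace_eq f f' \<Longrightarrow> mset f = mset f'"
  by (induction rule: rtranclp_induct) (auto elim!: swap_step.cases)

lemma trace_eq_length: "trace_eq f f' \<Longrightarrow> length f = length f'"
  by (metis trace_eq_mset size_mset)

lemma trace_eq_set: "trace_eq f f' \<Longrightarrow> set f = set f'"
  by (metis trace_eq_mset set_mset_mset)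

lemma trace_eq_move_front:
  assumes "\<forall>c\<in>set p. disjoint_perms a c"
  shows "trace_eq (p @ a # q) (a # p @ q)"
  using assms
proof (induction p)
  case (Cons c p)
  then have "trace_eq (c # p @ a # q) (c # a # p @ q)"
    using trace_eq_append[of "p @ a # q" "a # p @ q" "[c]" "[]"] by simp
  moreover have "swap_step (c # a # p @ q) (a # c # p @ q)"
    using Cons.prems swap_step.intros[of c a "[]" "p @ q"] by (simp add: disjoint_perms_sym)
  ultimately show ?case by simp
qed simp

text \<open>Of two distinct adjacent letters that are disjoint, at most one survives in such a
  projection. The case \<open>a = b\<close> is listed separately because the identity is disjoint
  from itself.\<close>

lemma trace_eq_projection:
  assumes "trace_eq f f'" "a = b \<or> \<not> disjoint_perms a b"
  shows "filter (\<lambda>c. c = a \<or> c = b) f = filter (\<lambda>c. c = a \<or> c = b) f'"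
  using assms(1)
proof (induction rule: rtranclp_induct)
  case (step f' f'')
  from step.hyps(2) show ?case
    unfolding step.IH by cases (use assms(2) disjoint_perms_sym in auto)
qed simp

text \<open>A letter \<open>c\<close> of \<open>p\<close> not disjoint from \<open>a\<close> would
  make the projection to \<open>a\<close>, \<open>c\<close> start inside \<open>p\<close>, hence
  with a letter other than \<open>a\<close>, whereas the right-hand side starts with
  \<open>a\<close>.\<close>

lemma projections_first_letter:
  assumes "\<And>c. \<not> disjoint_perms a c \<Longrightarrow>
      filter (\<lambda>x. x = a \<or> x = c) (p @ a # q) = filter (\<lambda>x. x = a \<or> x = c) (a # u)"
    and "a \<notin> set p"
  shows "\<forall>c\<in>set p. disjoint_perms a c"
proof (rule ballI, rule ccontr)
  fix c assume c: "c \<in> set p" "\<not> disjoint_perms a c"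
  let ?P = "filter (\<lambda>x. x = a \<or> x = c)"
  have "?P p \<noteq> []" using c(1) by (auto simp: filter_empty_conv)
  then have "hd (?P p) \<in> set p"
    using hd_in_set[of "?P p"] by (auto simp del: hd_in_set)
  moreover have "hd (?P p) = hd (?P (p @ a # q))" using \<open>?P p \<noteq> []\<close> by (simp add: hd_append)
  then have "hd (?P p) = a" by (simp only: assms(1)[OF c(2)]) simp
  ultimately show False using assms(2) by simp
qed

text \<open>A word is determined up to interchanges by its projections to pairs of letters that
  are equal or do not commute. This gives left cancellation.\<close>

lemma trace_eq_iff_projections:
  "trace_eq f f' \<longleftrightarrow> (\<forall>a b. a = b \<or> \<not> disjoint_perms a b \<longrightarrow>
     filter (\<lambda>c. c = a \<or> c = b) f = filter (\<lambda>c. c = a \<or> c = b) f')"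
proof
  assume "trace_eq f f'"
  then show "\<forall>a b. a = b \<or> \<not> disjoint_perms a b \<longrightarrow>
     filter (\<lambda>c. c = a \<or> c = b) f = filter (\<lambda>c. c = a \<or> c = b) f'"
    using trace_eq_projection by simp
next
  assume "\<forall>a b. a = b \<or> \<not> disjoint_perms a b \<longrightarrow>
     filter (\<lambda>c. c = a \<or> c = b) f = filter (\<lambda>c. c = a \<or> c = b) f'"
  then show "trace_eq f f'"
  proof (induction f arbitrary: f')
    case Nil
    \<comment> \<open>The projections with \<open>a = b\<close> count occurrences.\<close>
    have "a \<notin> set f'" for a
      using Nil.prems[rule_format, OF disjI1[OF refl], of a, symmetric]
      by (auto simp: filter_empty_conv)
    then have "f' = []" using hd_in_set[of f'] by blast
    then show ?case by simp
  next
    case (Cons a u)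
    have "a \<in> set (filter (\<lambda>c. c = a \<or> c = a) (a # u))" by simp
    also have "filter (\<lambda>c. c = a \<or> c = a) (a # u) = filter (\<lambda>c. c = a \<or> c = a) f'"
      by (rule Cons.prems[rule_format]) simp
    finally have "a \<in> set f'" by simp
    from split_list_first[OF this] obtain p q where f': "f' = p @ a # q" "a \<notin> set p" by blast
    \<comment> \<open>All letters before the first \<open>a\<close> in \<open>f'\<close> are
      disjoint from \<open>a\<close>, so \<open>a\<close> can be moved to the front and removed from
      every projection.\<close>
    have *: "\<forall>c\<in>set p. disjoint_perms a c"
    proof (rule projections_first_letter[of a p q u])
      fix c assume "\<not> disjoint_perms a c"
      then show "filter (\<lambda>x. x = a \<or> x = c) (p @ a # q) = filter (\<lambda>x. x = a \<or> x = c) (a # u)"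
        using Cons.prems[rule_format, of a c] f'(1) by simp
    qed (rule f'(2))
    have "filter (\<lambda>c. c = b \<or> c = d) u = filter (\<lambda>c. c = b \<or> c = d) (p @ q)"
      if "b = d \<or> \<not> disjoint_perms b d" for b d
    proof -
      have "filter (\<lambda>c. c = b \<or> c = d) (a # u) = filter (\<lambda>c. c = b \<or> c = d) (p @ a # q)"
        unfolding f'(1)[symmetric] by (rule Cons.prems[rule_format, OF that])
      also have "\<dots> = filter (\<lambda>c. c = b \<or> c = d) (a # p @ q)"
        by (rule trace_eq_projection[OF trace_eq_move_front[OF *] that])
      finally show ?thesis by (simp split: if_splits)
    qed
    then have "trace_eq u (p @ q)" by (intro Cons.IH allI impI)
    then have "trace_eq (a # u) (a # p @ q)"
      using trace_eq_append[of u "p @ q" "[a]" "[]"] by simp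
    moreover have "trace_eq (a # p @ q) f'"
      unfolding f'(1) by (rule trace_eq_sym[OF trace_eq_move_front[OF *]])
    ultimately show ?case by (rule rtranclp_trans)
  qed
qed

text \<open>Projections of a concatenation are concatenations, so the claim reduces to cancellation
  for lists.\<close>

lemma trace_eq_cancel_left: "trace_eq (v @ u) (v @ u') \<longleftrightarrow> trace_eq u u'"
  by (simp add: trace_eq_iff_projections)

text \<open>For a word of cycles, these are the minimal pieces of its heap.\<close>

definition first_letters :: "factorization \<Rightarrow> (nat \<Rightarrow> nat) set" where
  "first_letters w = {a. \<exists>u. trace_eq w (a # u)}"

lemma first_letters_subset: "first_letters w \<subseteq> set w"
  using trace_eq_set by (fastforce simp: first_letters_def)

text \<open>Otherwise the projection of \<open>w\<close> to \<open>a\<close>, \<open>b\<close> would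
  begin with both letters.\<close>

lemma disjoint_first_letters:
  assumes "a \<in> first_letters w" "b \<in> first_letters w" "a \<noteq> b"
  shows "disjoint_perms a b"
proof (rule ccontr)
  assume *: "\<not> disjoint_perms a b"
  obtain u v where "trace_eq w (a # u)" "trace_eq w (b # v)"
    using assms(1,2) by (auto simp: first_letters_def)
  then have "trace_eq (a # u) (b # v)" by (blast intro: rtranclp_trans trace_eq_sym)
  from trace_eq_projection[OF this, of a b] *
  have "filter (\<lambda>c. c = a \<or> c = b) (a # u) = filter (\<lambda>c. c = a \<or> c = b) (b # v)"
    by blast
  with assms(3) show False by simp
qed

text \<open>The cliques of Cartier and Foata, written as words; the order of the letters is
  immaterial up to \<open>trace_eq\<close>.\<close>

definition disjoint_list :: "factorization \<Rightarrow> bool" where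
  "disjoint_list vs \<longleftrightarrow> distinct vs \<and> (\<forall>a\<in>set vs. \<forall>b\<in>set vs. a \<noteq> b \<longrightarrow> disjoint_perms a b)"

text \<open>Each letter of a clique commutes past those before it. With
  \<open>first_letters_prefix\<close> this identifies the cliques that can open \<open>w\<close>
  with the sets of its first letters.\<close>

lemma disjoint_list_prefix_first_letters:
  assumes "trace_eq w (vs @ u)" "disjoint_list vs"
  shows "set vs \<subseteq> first_letters w"
proof
  fix a assume "a \<in> set vs"
  then obtain p q where vs: "vs = p @ a # q" by (meson split_list)
  with assms(2) have "\<forall>c\<in>set p. disjoint_perms a c" by (auto simp: disjoint_list_def)
  then have "trace_eq (p @ a # q @ u) (a # p @ q @ u)" by (rule trace_eq_move_front)
  with assms(1) vs have "trace_eq w (a # p @ q @ u)" by (auto intro: rtranclp_trans)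
  then show "a \<in> first_letters w" by (auto simp: first_letters_def)
qed

text \<open>Once \<open>vs\<close> is at the front, the next first letter \<open>a\<close> must
  occur in the rest \<open>u\<close>, and everything before its first occurrence is disjoint from
  it. So first letters move to the front together, in any order.\<close>

lemma first_letters_prefix:
  assumes "distinct vs" "set vs \<subseteq> first_letters w"
  shows "\<exists>u. trace_eq w (vs @ u)"
  using assms
proof (induction vs rule: rev_induct)
  case (snoc a vs)
  then obtain u where u: "trace_eq w (vs @ u)" by auto
  obtain w' where w': "trace_eq w (a # w')" using snoc.prems by (auto simp: first_letters_def)
  have eq: "trace_eq (vs @ u) (a # w')" using u w' trace_eq_sym rtranclp_trans by metis
  from trace_eq_set[OF this] have "a \<in> set u" using snoc.prems by auto
  then obtain p q where p: "u = p @ a # q" "a \<notin> set p" by (meson split_list_first)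
  \<comment> \<open>Since \<open>w\<close> can be made to begin with \<open>a\<close>, so do its
    projections to \<open>a\<close> and any letter not disjoint from \<open>a\<close>.\<close>
  have "\<forall>c\<in>set (vs @ p). disjoint_perms a c"
  proof (rule projections_first_letter[where q = q and u = w'])
    show "a \<notin> set (vs @ p)" using p snoc.prems by simp
    fix c assume "\<not> disjoint_perms a c"
    then show "filter (\<lambda>x. x = a \<or> x = c) ((vs @ p) @ a # q) = filter (\<lambda>x. x = a \<or> x = c) (a # w')"
      using trace_eq_projection[OF eq, of a c] p(1) by simp
  qed
  then have "trace_eq u (a # p @ q)" unfolding p by (intro trace_eq_move_front) simp
  then have "trace_eq (vs @ u) (vs @ a # p @ q)" by (simp add: trace_eq_cancel_left)
  with u have "trace_eq w (vs @ a # p @ q)" by simp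
  then show ?case by auto
qed auto

section \<open>Disjoint cycle decompositions\<close>

text \<open>The cycle acts on its list by rotation, so the powers of \<open>c\<close> lead from any
  entry to any other, and \<open>length cs \<ge> 2\<close> makes every entry move.\<close>

lemma nontrivial_cycle_orbit:
  assumes "c \<in> nontrivial_cycles n" "c x \<noteq> x"
  shows "orbit c x = {y. c y \<noteq> y}"
proof -
  obtain cs where c: "c = cycle_of_list cs" and cs: "distinct cs" "length cs \<ge> 2"
    using assms(1) by (auto simp: nontrivial_cycles_def)
  have pow: "(c ^^ m) (cs ! i) = cs ! ((m + i) mod length cs)" if "i < length cs" for m i
    using arg_cong[OF cyclic_rotation[OF cs(1), of m], of "\<lambda>l. l ! i"] that
    by (simp add: c nth_rotate)
  have supp: "{y. c y \<noteq> y} = set cs"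
  proof (intro equalityI subsetI)
    fix y assume "y \<in> set cs"
    then obtain i where i: "i < length cs" "y = cs ! i" by (auto simp: in_set_conv_nth)
    have "(1 + i) mod length cs \<noteq> i"
      using i(1) cs(2) by (cases "Suc i = length cs") auto
    then have "cs ! ((1 + i) mod length cs) \<noteq> cs ! i"
      using i(1) cs by (subst nth_eq_iff_index_eq) (auto intro!: mod_less_divisor)
    then show "y \<in> {y. c y \<noteq> y}" using pow[OF i(1), of 1] i(2) by simp
  qed (use id_outside_supp[of _ cs] c in force)
  have perm: "permutation c" unfolding c by (rule permutation_of_cycle)
  from assms(2) supp have "x \<in> set cs" by blast
  then obtain i where i: "i < length cs" "x = cs ! i" by (auto simp: in_set_conv_nth)
  have "orbit c x = set cs"
  proof (intro equalityI subsetI)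
    fix y assume "y \<in> orbit c x"
    then obtain m where "y = (c ^^ m) x" by (auto simp: orbit_altdef)
    then have "y = cs ! ((m + i) mod length cs)" using pow[OF i(1)] i(2) by simp
    then show "y \<in> set cs" using cs(2) by (auto intro!: nth_mem mod_less_divisor)
  next
    fix y assume "y \<in> set cs"
    then obtain j where j: "j < length cs" "y = cs ! j" by (auto simp: in_set_conv_nth)
    \<comment> \<open>Going from index \<open>i\<close> to the end and on to \<open>j\<close> avoids
      the truncated difference \<open>j - i\<close>.\<close>
    have "(j + (length cs - i) + i) mod length cs = j" using i(1) j(1) by simp
    then have "(c ^^ (j + (length cs - i))) x = y" using pow[OF i(1)] i(2) j(2) by simp
    then show "y \<in> orbit c x" by (auto simp: orbit_altdef_permutation[OF perm])
  qed
  with supp show ?thesis by simp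
qed

lemma nontrivial_cycle_moves:
  assumes "c \<in> nontrivial_cycles n"
  shows "\<exists>x. c x \<noteq> x"
proof -
  obtain cs where c: "c = cycle_of_list cs" and cs: "distinct cs" "length cs \<ge> 2"
    using assms by (auto simp: nontrivial_cycles_def)
  then obtain a b cs' where ab: "cs = a # b # cs'"
    by (metis Suc_le_length_iff numeral_2_eq_2)
  have "map c cs = rotate1 cs"
    using cyclic_rotation[OF cs(1), of 1] c by simp
  then have "c a = b" using ab by simp
  with cs(1) ab show ?thesis by (intro exI[of _ a]) auto
qed

lemma finite_nontrivial_cycles: "finite (nontrivial_cycles n)"
  by (rule finite_subset[OF _ finite_permutations[of "{1..n}"]])
    (use nontrivial_cycles_permute in blast, simp)

text \<open>The disjoint cycles of \<sigma>, described pointwise: a nontrivial cycle that agrees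
  with \<sigma> wherever it moves a point has an orbit of \<sigma> as its support. The pointwise
  form is also what the comparison of orbits in \<open>transitive_refine\<close> uses.\<close>

definition cycle_factors :: "nat \<Rightarrow> (nat \<Rightarrow> nat) \<Rightarrow> (nat \<Rightarrow> nat) set" where
  "cycle_factors n \<sigma> = {c \<in> nontrivial_cycles n. \<forall>x. c x = x \<or> c x = \<sigma> x}"

lemma finite_cycle_factors: "finite (cycle_factors n \<sigma>)"
  using finite_nontrivial_cycles by (simp add: cycle_factors_def)

lemma cycle_factors_subset: "cycle_factors n \<sigma> \<subseteq> nontrivial_cycles n"
  by (auto simp: cycle_factors_def)

lemma cycle_factor_moves:
  assumes "c \<in> cycle_factors n \<sigma>"
  shows "\<exists>x. c x \<noteq> x \<and> \<sigma> x \<noteq> x"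
proof -
  from assms obtain x where "c x \<noteq> x"
    using nontrivial_cycle_moves cycle_factors_subset by blast
  moreover from assms have "c x = x \<or> c x = \<sigma> x" by (simp add: cycle_factors_def)
  ultimately show ?thesis by (intro exI[of _ x]) simp
qed

lemma inj_nontrivial_cycle: "c \<in> nontrivial_cycles n \<Longrightarrow> inj c"
  using nontrivial_cycles_permute permutes_inj by blast

text \<open>On its support \<open>c\<close> agrees with \<sigma>, and that support is a single orbit
  of \<open>c\<close>.\<close>

lemma cycle_factor_orbit:
  assumes "c \<in> cycle_factors n \<sigma>" "c x \<noteq> x"
  shows "orbit \<sigma> x = {y. c y \<noteq> y}"
proof -
  have c: "c \<in> nontrivial_cycles n" "\<And>x. c x = x \<or> c x = \<sigma> x"
    using assms(1) by (auto simp: cycle_factors_def)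
  note supp = nontrivial_cycle_orbit[OF c(1) assms(2)]
  have "orbit \<sigma> x = orbit c x"
  proof (rule orbit_cong)
    show "x \<in> orbit c x" using supp assms(2) by simp
    fix y assume "y \<in> orbit c x"
    then show "\<sigma> y = c y" using supp c(2)[of y] by auto
  qed
  with supp show ?thesis by simp
qed

text \<open>A common moved point makes both supports the same orbit of \<sigma>, and there both
  cycles agree with \<sigma>.\<close>

lemma cycle_factor_unique:
  assumes "c \<in> cycle_factors n \<sigma>" "c' \<in> cycle_factors n \<sigma>" "c x \<noteq> x" "c' x \<noteq> x"
  shows "c = c'"
proof
  fix y
  have "{y. c y \<noteq> y} = {y. c' y \<noteq> y}"
    using cycle_factor_orbit assms by metis
  moreover have "c y = y \<or> c y = \<sigma> y" "c' y = y \<or> c' y = \<sigma> y"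
    using assms(1,2) by (auto simp: cycle_factors_def)
  ultimately show "c y = c' y" by (auto simp: set_eq_iff) metis+
qed

lemma disjoint_cycle_factors:
  assumes "c \<in> cycle_factors n \<sigma>" "c' \<in> cycle_factors n \<sigma>" "c \<noteq> c'"
  shows "disjoint_perms c c'"
  using cycle_factor_unique[OF assms(1,2)] assms(3) by (auto simp: disjoint_perms_def)

text \<open>The cycle through \<open>x\<close> lists \<open>x\<close>, \<open>\<sigma> x\<close> and
  so on up to the first return; it has at least two entries because \<sigma> moves
  \<open>x\<close>.\<close>

lemma cycle_factor_exists:
  assumes "\<sigma> permutes {1..n}" "\<sigma> x \<noteq> x"
  shows "\<exists>c\<in>cycle_factors n \<sigma>. c x \<noteq> x"
proof -
  have perm: "permutation \<sigma>" using assms(1) by (auto simp: permutation_permutes)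
  let ?cs = "support \<sigma> x"
  have x: "x \<in> set ?cs" using least_power_of_permutation(2)[OF perm, of x] by force
  have len: "length ?cs \<ge> 2" using least_power_gt_one[OF perm assms(2)] by simp
  have "(\<sigma> ^^ i) x \<in> {1..n}" for i
    using permutes_in_image[OF permutes_funpow[OF assms(1)]] assms permutes_not_in by metis
  then have "set ?cs \<subseteq> {1..n}" by auto
  then have "cycle_of_list ?cs \<in> nontrivial_cycles n"
    unfolding nontrivial_cycles_def using cycle_of_permutation[OF perm] len by blast
  moreover have "cycle_of_list ?cs y = y \<or> cycle_of_list ?cs y = \<sigma> y" for y
    using cycle_restrict[OF perm] id_outside_supp by metis
  ultimately have "cycle_of_list ?cs \<in> cycle_factors n \<sigma>" by (simp add: cycle_factors_def)
  moreover have "cycle_of_list ?cs x \<noteq> x" using cycle_restrict[OF perm x] assms(2) by simp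
  ultimately show ?thesis by blast
qed

lemma cycle_factors_nontrivial_cycle:
  assumes "c \<in> nontrivial_cycles n"
  shows "cycle_factors n c = {c}"
proof -
  have "c \<in> cycle_factors n c" using assms by (simp add: cycle_factors_def)
  moreover have "c' = c" if c': "c' \<in> cycle_factors n c" for c'
  proof -
    obtain x where "c' x \<noteq> x" "c x \<noteq> x" using cycle_factor_moves[OF c'] by blast
    then show ?thesis using cycle_factor_unique[OF c' \<open>c \<in> cycle_factors n c\<close>] by blast
  qed
  ultimately show ?thesis by blast
qed

section \<open>Products of disjoint cycles\<close>

lemma target_Cons: "target (a # f) = a \<circ> target f"
  by (simp add: target_def)

lemma target_append: "target (f @ f') = target f \<circ> target f'"
  by (induction f) (auto simp: target_def)

lemma target_Nil: "target [] = id"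
  by (simp add: target_def)

lemma target_permutes: "\<forall>\<sigma>\<in>set f. \<sigma> permutes S \<Longrightarrow> target f permutes S"
  by (induction f) (auto simp: target_Nil target_Cons permutes_id intro: permutes_compose)

lemma target_fixes: "\<forall>a\<in>set f. a x = x \<Longrightarrow> target f x = x"
  by (induction f) (auto simp: target_Nil target_Cons)

text \<open>The other letters fix both \<open>x\<close> and \<open>c x\<close>; the latter point is
  moved by \<open>c\<close> because \<open>c\<close> is injective.\<close>

lemma target_disjoint_list:
  assumes "disjoint_list vs" "\<forall>a\<in>set vs. inj a" "c \<in> set vs" "c x \<noteq> x"
  shows "target vs x = c x"
  using assms(1-3)
proof (induction vs)
  case (Cons a vs)
  show ?case
  proof (cases "c = a")
    case True
    then have "\<forall>b\<in>set vs. b x = x"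
      using Cons.prems(1) assms(4) by (fastforce simp: disjoint_list_def disjoint_perms_def)
    then show ?thesis using True by (simp add: target_Cons target_fixes)
  next
    case False
    then have "disjoint_perms a c" using Cons.prems by (auto simp: disjoint_list_def)
    moreover have "c (c x) \<noteq> c x" using Cons.prems assms(4) by (auto dest: injD)
    ultimately have "a (c x) = c x" by (auto simp: disjoint_perms_def)
    moreover have "target vs x = c x"
      using Cons False by (auto simp: disjoint_list_def)
    ultimately show ?thesis by (simp add: target_Cons)
  qed
qed simp

lemma target_cycle_factors:
  assumes "\<sigma> permutes {1..n}" "set vs = cycle_factors n \<sigma>" "distinct vs"
  shows "target vs = \<sigma>"
proof
  fix x
  have dis: "disjoint_list vs"
    using assms(2,3) disjoint_cycle_factors by (auto simp: disjoint_list_def)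
  have inj: "\<forall>a\<in>set vs. inj a"
    using assms(2) cycle_factors_subset inj_nontrivial_cycle by blast
  show "target vs x = \<sigma> x"
  proof (cases "\<sigma> x = x")
    case True
    then show ?thesis using assms(2) by (intro target_fixes[THEN trans]) (auto simp: cycle_factors_def)
  next
    case False
    with cycle_factor_exists[OF assms(1)] assms(2) obtain c where
      c: "c \<in> set vs" "c x \<noteq> x" by auto
    then show ?thesis
      using target_disjoint_list[OF dis inj c] assms(2) by (auto simp: cycle_factors_def)
  qed
qed

text \<open>Uniqueness of the cycle decomposition. A cycle factor of the product moves a point that
  some letter of \<open>vs\<close> moves as well, and two cycle factors moving a common point
  coincide.\<close>

lemma cycle_factors_target:
  assumes "disjoint_list vs" "set vs \<subseteq> nontrivial_cycles n"
  shows "cycle_factors n (target vs) = set vs"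
proof -
  have inj: "\<forall>a\<in>set vs. inj a"
    using assms(2) inj_nontrivial_cycle by blast
  have sub: "set vs \<subseteq> cycle_factors n (target vs)"
    using target_disjoint_list[OF assms(1) inj] assms(2) by (fastforce simp: cycle_factors_def)
  have "c \<in> set vs" if c: "c \<in> cycle_factors n (target vs)" for c
  proof -
    obtain x where x: "c x \<noteq> x" "target vs x \<noteq> x" using cycle_factor_moves[OF c] by blast
    then obtain c' where "c' \<in> set vs" "c' x \<noteq> x" using target_fixes by blast
    then show ?thesis using cycle_factor_unique[OF c _ x(1)] sub by blast
  qed
  with sub show ?thesis by blast
qed

text \<open>The order is arbitrary, but it is chosen as a function of the set
  \<open>cycle_factors n \<sigma>\<close> alone: permutations with the same cycle factors get the
  same list, hence are equal.\<close>

definition cycle_list :: "nat \<Rightarrow> (nat \<Rightarrow> nat) \<Rightarrow> factorization" where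
  "cycle_list n \<sigma> = (SOME vs. set vs = cycle_factors n \<sigma> \<and> distinct vs)"

lemma set_cycle_list: "set (cycle_list n \<sigma>) = cycle_factors n \<sigma>"
  and distinct_cycle_list: "distinct (cycle_list n \<sigma>)"
  using someI_ex[OF finite_distinct_list[OF finite_cycle_factors[of n \<sigma>]]]
  by (simp_all add: cycle_list_def)

lemma disjoint_list_cycle_list: "disjoint_list (cycle_list n \<sigma>)"
  using disjoint_cycle_factors
  by (auto simp: disjoint_list_def set_cycle_list distinct_cycle_list)

lemma target_cycle_list: "\<sigma> permutes {1..n} \<Longrightarrow> target (cycle_list n \<sigma>) = \<sigma>"
  by (rule target_cycle_factors) (simp_all add: set_cycle_list distinct_cycle_list)

lemma length_cycle_list: "length (cycle_list n \<sigma>) = card (cycle_factors n \<sigma>)"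
  by (metis distinct_card distinct_cycle_list set_cycle_list)

lemma cycle_list_eq_Nil_iff:
  assumes "\<sigma> permutes {1..n}"
  shows "cycle_list n \<sigma> = [] \<longleftrightarrow> \<sigma> = id"
proof
  assume "\<sigma> = id"
  then have "cycle_factors n \<sigma> = {}" using cycle_factor_moves by fastforce
  then show "cycle_list n \<sigma> = []" using set_cycle_list[of n \<sigma>] by simp
qed (use target_cycle_list[OF assms] target_Nil in auto)

text \<open>Taking supports matches the cycle factors with the orbits of at least two elements.
  Injectivity of this map keeps the multiplicities when several cycles have the same length.\<close>

lemma perm_signature_cycle_factors:
  assumes "\<sigma> permutes {1..n}"
  shows "perm_signature n \<sigma> = image_mset (\<lambda>c. card {y. c y \<noteq> y}) (mset_set (cycle_factors n \<sigma>))"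
proof -
  let ?supp = "\<lambda>c :: nat \<Rightarrow> nat. {y. c y \<noteq> y}"
  have perm: "permutation \<sigma>" using assms by (auto simp: permutation_permutes)
  have card: "card (orbit \<sigma> x) \<ge> 2 \<longleftrightarrow> \<sigma> x \<noteq> x" for x
  proof
    assume *: "\<sigma> x \<noteq> x"
    have "{x, \<sigma> x} \<subseteq> orbit \<sigma> x"
      using permutation_self_in_orbit[OF perm] orbit.base by auto
    then have "card {x, \<sigma> x} \<le> card (orbit \<sigma> x)"
      by (intro card_mono finite_orbit permutation_self_in_orbit perm)
    with * show "card (orbit \<sigma> x) \<ge> 2" by simp
  next
    assume *: "card (orbit \<sigma> x) \<ge> 2"
    show "\<sigma> x \<noteq> x"
    proof
      assume "\<sigma> x = x"
      then have "orbit \<sigma> x = {x}" by (simp add: orbit_eq_singleton_iff)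
      with * show False by simp
    qed
  qed
  have "{S \<in> cycles_of n \<sigma>. card S \<ge> 2} = ?supp ` cycle_factors n \<sigma>"
  proof (intro equalityI subsetI)
    fix S assume "S \<in> {S \<in> cycles_of n \<sigma>. card S \<ge> 2}"
    then obtain x where x: "S = orbit \<sigma> x" "\<sigma> x \<noteq> x" using card by (auto simp: cycles_of_def)
    obtain c where c: "c \<in> cycle_factors n \<sigma>" "c x \<noteq> x"
      using cycle_factor_exists[OF assms x(2)] by blast
    then show "S \<in> ?supp ` cycle_factors n \<sigma>" using cycle_factor_orbit x(1) by blast
  next
    fix S assume "S \<in> ?supp ` cycle_factors n \<sigma>"
    then obtain c where c: "c \<in> cycle_factors n \<sigma>" "S = ?supp c" by blast
    obtain x where x: "c x \<noteq> x" and mv: "\<sigma> x \<noteq> x" using cycle_factor_moves[OF c(1)] by blast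
    then have "x \<in> {1..n}" using assms permutes_not_in by metis
    then show "S \<in> {S \<in> cycles_of n \<sigma>. card S \<ge> 2}"
      using cycle_factor_orbit[OF c(1) x] c(2) card[of x] mv by (auto simp: cycles_of_def)
  qed
  moreover have "inj_on ?supp (cycle_factors n \<sigma>)"
  proof (rule inj_onI)
    fix c c' assume cc: "c \<in> cycle_factors n \<sigma>" "c' \<in> cycle_factors n \<sigma>" "?supp c = ?supp c'"
    obtain x where "c x \<noteq> x" using cycle_factor_moves[OF cc(1)] by blast
    with cc(3) have "c' x \<noteq> x" by blast
    with \<open>c x \<noteq> x\<close> show "c = c'" using cycle_factor_unique cc(1,2) by blast
  qed
  moreover have "perm_signature n \<sigma> = image_mset card (mset_set {S \<in> cycles_of n \<sigma>. card S \<ge> 2})"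
    by (simp add: perm_signature_def filter_mset_image_mset cycles_of_def)
  ultimately show ?thesis
    by (simp add: image_mset_mset_set[symmetric] multiset.map_comp comp_def)
qed

lemma signature_Cons: "signature n (a # f) = perm_signature n a + signature n f"
  by (simp add: signature_def)

lemma signature_append: "signature n (f @ f') = signature n f + signature n f'"
  by (simp add: signature_def)

lemma signature_cycle_list:
  assumes "\<sigma> permutes {1..n}"
  shows "signature n (cycle_list n \<sigma>) = perm_signature n \<sigma>"
proof -
  \<comment> \<open>A nontrivial cycle is its own only factor, so for words of cycles the signature
    collects the support sizes.\<close>
  have "signature n vs = image_mset (\<lambda>c. card {y. c y \<noteq> y}) (mset vs)"
    if "set vs \<subseteq> nontrivial_cycles n" for vs
    using that
  proof (induction vs)
    case (Cons c vs)
    then show ?case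
      using perm_signature_cycle_factors[OF nontrivial_cycles_permute, of c n]
      by (simp add: signature_Cons cycle_factors_nontrivial_cycle)
  qed (simp add: signature_def)
  then show ?thesis
    using mset_set_set[OF distinct_cycle_list, of n \<sigma>]
    by (auto simp: perm_signature_cycle_factors[OF assms] set_cycle_list cycle_factors_def)
qed

lemma perm_signature_id: "perm_signature n id = {#}"
proof -
  have "cycle_factors n id = {}" using cycle_factor_moves by fastforce
  then show ?thesis by (simp add: perm_signature_cycle_factors[OF permutes_id])
qed

text \<open>The source of the constant coefficient 1 of the series of all permutations, and of the
  bound on the length of a proper factorization by the size of its signature.\<close>

lemma perm_signature_eq_empty_iff:
  assumes "\<sigma> permutes {1..n}"
  shows "perm_signature n \<sigma> = {#} \<longleftrightarrow> \<sigma> = id"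
proof -
  have "perm_signature n \<sigma> = {#} \<longleftrightarrow> cycle_factors n \<sigma> = {}"
    using perm_signature_cycle_factors[OF assms] finite_cycle_factors
    by (simp add: mset_set_empty_iff)
  also have "\<dots> \<longleftrightarrow> \<sigma> = id"
    using cycle_list_eq_Nil_iff[OF assms] set_cycle_list[of n \<sigma>] by (metis set_empty)
  finally show ?thesis .
qed

section \<open>Refining a factorization into cycles\<close>

definition refine :: "nat \<Rightarrow> factorization \<Rightarrow> factorization" where
  "refine n f = concat (map (cycle_list n) f)"

lemma refine_Cons: "refine n (\<sigma> # f) = cycle_list n \<sigma> @ refine n f"
  by (simp add: refine_def)

lemma refine_in_cycle_factorizations: "refine n f \<in> cycle_factorizations n"
  using cycle_factors_subset
  by (auto simp: refine_def cycle_factorizations_def set_cycle_list)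

lemma proper_factorizations_alt:
  "f \<in> proper_factorizations n \<longleftrightarrow> (\<forall>\<sigma>\<in>set f. \<sigma> permutes {1..n} \<and> \<sigma> \<noteq> id)"
  by (auto simp: proper_factorizations_def sym_group_carrier)

lemma cycle_factorizations_proper: "cycle_factorizations n \<subseteq> proper_factorizations n"
  unfolding subset_iff proper_factorizations_alt cycle_factorizations_def
  using nontrivial_cycles_permute nontrivial_cycle_moves by fastforce

lemma target_in_sym_group:
  "f \<in> proper_factorizations n \<Longrightarrow> target f \<in> carrier (sym_group n)"
  by (simp add: sym_group_carrier target_permutes proper_factorizations_alt)

lemma target_refine: "f \<in> proper_factorizations n \<Longrightarrow> target (refine n f) = target f"
  unfolding proper_factorizations_alt
  by (induction f)
    (simp_all add: refine_def target_append target_Cons target_cycle_list)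

lemma signature_refine: "f \<in> proper_factorizations n \<Longrightarrow> signature n (refine n f) = signature n f"
  unfolding proper_factorizations_alt
  by (induction f)
    (simp_all add: refine_def signature_append signature_Cons signature_cycle_list)

text \<open>Makes the set of proper factorizations that refine to a given class finite.\<close>

lemma length_le_length_refine:
  "f \<in> proper_factorizations n \<Longrightarrow> length f \<le> length (refine n f)"
  unfolding proper_factorizations_alt
proof (induction f)
  case (Cons \<sigma> f)
  then have "cycle_list n \<sigma> \<noteq> []" using cycle_list_eq_Nil_iff[of \<sigma> n] by force
  then have "length (cycle_list n \<sigma>) \<ge> 1" by (simp add: Suc_leI)
  moreover have "length f \<le> length (refine n f)" using Cons by simp
  ultimately show ?case unfolding refine_Cons length_append by simp
qed simp

lemma length_le_size_signature:
  "f \<in> proper_factorizations n \<Longrightarrow> length f \<le> size (signature n f)"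
  unfolding proper_factorizations_alt
proof (induction f)
  case (Cons \<sigma> f)
  then have "perm_signature n \<sigma> \<noteq> {#}" using perm_signature_eq_empty_iff[of \<sigma> n] by force
  then have "size (perm_signature n \<sigma>) > 0" by (simp add: nonempty_has_size)
  with Cons show ?case by (simp add: signature_Cons)
qed simp

lemma finite_sym_group: "finite (carrier (sym_group n))"
  by (simp add: sym_group_def finite_permutations)

lemma finite_proper_bounded:
  "finite {f \<in> proper_factorizations n. length f \<le> m}"
  by (rule finite_subset[OF _ finite_lists_length_le[OF finite_sym_group[of n], of m]])
    (auto simp: proper_factorizations_def)

lemma finite_proper_signature: "finite {f \<in> proper_factorizations n. signature n f = b}"
  by (rule finite_subset[OF _ finite_proper_bounded[of n "size b"]])
    (use length_le_size_signature in blast)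

text \<open>Every cycle factor of \<open>\<sigma>\<close> moves a point either not at all or as \<open>\<sigma>\<close> does, so
  refinement does not change the orbits.\<close>

lemma transitive_refine:
  assumes "f \<in> proper_factorizations n"
  shows "transitive n (refine n f) \<longleftrightarrow> transitive n f"
proof -
  interpret group "sym_group n" by (rule sym_group_is_group)
  let ?G = "sym_group n"
  have f: "\<sigma> permutes {1..n}" if "\<sigma> \<in> set f" for \<sigma>
    using assms that by (simp add: proper_factorizations_alt)
  have ref: "\<exists>\<sigma>\<in>set f. c \<in> cycle_factors n \<sigma>" if "c \<in> set (refine n f)" for c
    using that by (auto simp: refine_def set_cycle_list)
  have word: "target vs \<in> generate ?G H" if "set vs \<subseteq> H" for vs H
    using that
  proof (induction vs)
    case Nil
    show ?case using generate.one[of ?G H] unfolding target_Nil sym_group_one .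
  next
    case (Cons a vs)
    have "a \<in> generate ?G H" using Cons.prems by (intro generate.incl) simp
    moreover have "target vs \<in> generate ?G H" using Cons by simp
    ultimately have "a \<otimes>\<^bsub>?G\<^esub> target vs \<in> generate ?G H" by (rule generate.eng)
    then show ?case unfolding target_Cons sym_group_mult .
  qed
  have sub: "generate ?G (set f) \<subseteq> generate ?G (set (refine n f))"
  proof
    fix p assume "p \<in> generate ?G (set f)"
    then show "p \<in> generate ?G (set (refine n f))"
    proof induction
      case one
      then show ?case by (rule generate.one)
    next
      case (incl h)
      then have "target (cycle_list n h) \<in> generate ?G (set (refine n f))"
        by (intro word) (auto simp: refine_def)
      then show ?case using f[OF incl] by (simp add: target_cycle_list)
    next
      case (inv h)
      have "set (refine n f) \<subseteq> carrier ?G"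
        using refine_in_cycle_factorizations[of n f] cycle_factorizations_proper[of n]
        by (auto simp: proper_factorizations_def)
      moreover have "target (cycle_list n h) \<in> generate ?G (set (refine n f))"
        using inv by (intro word) (auto simp: refine_def)
      ultimately show ?case
        using f[OF inv] by (simp add: target_cycle_list generate_m_inv_closed)
    next
      case (eng h1 h2)
      from eng.IH show ?case by (rule generate.eng)
    qed
  qed
  \<comment> \<open>The reverse inclusion of subgroups fails in general, as a single cycle of a
    factor need not lie in the group generated by \<open>f\<close>. Hence only a pointwise
    statement, with \<open>q\<close> depending on \<open>x\<close>.\<close>
  have orbit: "\<exists>q\<in>generate ?G (set f). p x = q x" if "p \<in> generate ?G (set (refine n f))" for p x
    using that
  proof (induction arbitrary: x)
    case one
    then show ?case using generate.one by blast
  next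
    case (incl c)
    then obtain \<sigma> where \<sigma>: "\<sigma> \<in> set f" "c \<in> cycle_factors n \<sigma>" using ref by blast
    then have "c x = x \<or> c x = \<sigma> x" by (simp add: cycle_factors_def)
    moreover have "id \<in> generate ?G (set f)" using generate.one[of ?G] unfolding sym_group_one by blast
    ultimately show ?case using generate.incl[OF \<sigma>(1), of ?G] by (metis id_apply)
  next
    case (inv c)
    then obtain \<sigma> where \<sigma>: "\<sigma> \<in> set f" "c \<in> cycle_factors n \<sigma>" using ref by blast
    then have c: "c permutes {1..n}" using cycle_factors_subset nontrivial_cycles_permute by blast
    \<comment> \<open>The pointwise description of \<open>c\<close>, applied at the preimage of
      \<open>x\<close>, shows that the inverse of \<open>c\<close> either fixes \<open>x\<close> or
      acts on it as the inverse of \<sigma>.\<close>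
    let ?y = "inv' c x"
    have y: "c ?y = x" using permutes_inverses(1)[OF c] .
    have "c ?y = ?y \<or> c ?y = \<sigma> ?y" using \<sigma>(2) by (simp add: cycle_factors_def)
    then have "?y = id x \<or> ?y = inv' \<sigma> x"
      unfolding y using permutes_inverses(2)[OF f[OF \<sigma>(1)], of ?y] by auto
    moreover have "id \<in> generate ?G (set f)" using generate.one[of ?G] unfolding sym_group_one by blast
    moreover have "inv' \<sigma> \<in> generate ?G (set f)"
      using generate.inv[OF \<sigma>(1), of ?G] f[OF \<sigma>(1)] by (simp add: sym_group_carrier)
    moreover have "inv\<^bsub>?G\<^esub> c = inv' c" using c by (simp add: sym_group_carrier)
    ultimately show ?case by metis
  next
    case (eng p p')
    obtain q' where q': "q' \<in> generate ?G (set f)" "p' x = q' x" using eng.IH(2) by blast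
    obtain q where q: "q \<in> generate ?G (set f)" "p (q' x) = q (q' x)" using eng.IH(1) by blast
    have "(p \<otimes>\<^bsub>?G\<^esub> p') x = (q \<otimes>\<^bsub>?G\<^esub> q') x" using q q' by (simp add: sym_group_mult)
    then show ?case using generate.eng[OF q(1) q'(1)] by blast
  qed
  show ?thesis unfolding transitive_def
    using sub orbit by (metis subsetD)
qed

lemma transitive_of_genus_refine:
  assumes "f \<in> proper_factorizations n"
  shows "transitive_of_genus n g (refine n f) = transitive_of_genus n g f"
  using assms
  by (simp add: transitive_of_genus_def depth_def transitive_refine target_refine signature_refine)

section \<open>Signed count of the factorizations that refine to a given class\<close>

lemma sum_Pow_alternating:
  assumes "finite M" "M \<noteq> {}"
  shows "(\<Sum>V\<in>Pow M. (-1) ^ card V) = (0 :: 'a :: comm_ring_1)"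
  \<comment> \<open>The expansion of the product of \<open>1 - 1\<close> over
    \<open>M\<close>.\<close>
  using prod_diff_conv_sum[OF assms(1), of "\<lambda>_. 1 :: 'a" "\<lambda>_. 1"] assms
  by (simp add: power_0_left card_eq_0_iff)

text \<open>First letters are pairwise disjoint, so every nonempty set of them is the set of cycles
  of exactly one nonidentity permutation, the product of its members.\<close>

lemma bij_betw_cycle_factors:
  assumes "w \<in> cycle_factorizations n"
  shows "bij_betw (cycle_factors n)
    {\<sigma>. \<sigma> permutes {1..n} \<and> \<sigma> \<noteq> id \<and> cycle_factors n \<sigma> \<subseteq> first_letters w}
    (Pow (first_letters w) - {{}})"
  unfolding bij_betw_def
proof (intro conjI inj_onI equalityI subsetI)
  fix \<sigma> \<tau>
  assume "\<sigma> \<in> {\<sigma>. \<sigma> permutes {1..n} \<and> \<sigma> \<noteq> id \<and> cycle_factors n \<sigma> \<subseteq> first_letters w}"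
    "\<tau> \<in> {\<sigma>. \<sigma> permutes {1..n} \<and> \<sigma> \<noteq> id \<and> cycle_factors n \<sigma> \<subseteq> first_letters w}"
    and eq: "cycle_factors n \<sigma> = cycle_factors n \<tau>"
  then have "target (cycle_list n \<sigma>) = \<sigma>" "target (cycle_list n \<tau>) = \<tau>"
    by (auto intro: target_cycle_list)
  with eq show "\<sigma> = \<tau>" by (simp add: cycle_list_def)
next
  fix V
  assume "V \<in> cycle_factors n `
    {\<sigma>. \<sigma> permutes {1..n} \<and> \<sigma> \<noteq> id \<and> cycle_factors n \<sigma> \<subseteq> first_letters w}"
  then obtain \<sigma> where \<sigma>: "\<sigma> permutes {1..n}" "\<sigma> \<noteq> id" "V = cycle_factors n \<sigma>"
    "V \<subseteq> first_letters w" by blast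
  then have "V \<noteq> {}" using cycle_list_eq_Nil_iff[OF \<sigma>(1)] set_cycle_list[of n \<sigma>] by auto
  with \<sigma> show "V \<in> Pow (first_letters w) - {{}}" by simp
next
  fix V assume V: "V \<in> Pow (first_letters w) - {{}}"
  then have "V \<subseteq> set w" using first_letters_subset by blast
  then have "finite V" by (rule finite_subset) simp
  then obtain vs where vs: "set vs = V" "distinct vs" using finite_distinct_list by blast
  have cyc: "set vs \<subseteq> nontrivial_cycles n"
    using \<open>V \<subseteq> set w\<close> vs assms by (auto simp: cycle_factorizations_def)
  have "disjoint_list vs"
    using vs V disjoint_first_letters[of _ w] by (auto simp: disjoint_list_def)
  then have K: "cycle_factors n (target vs) = V" using cycle_factors_target cyc vs(1) by blast
  have "target vs permutes {1..n}"
    using cyc nontrivial_cycles_permute by (intro target_permutes) blast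
  moreover from this have "target vs \<noteq> id"
    using cycle_list_eq_Nil_iff[of "target vs" n] set_cycle_list[of n "target vs"] K V by auto
  ultimately show "V \<in> cycle_factors n `
    {\<sigma>. \<sigma> permutes {1..n} \<and> \<sigma> \<noteq> id \<and> cycle_factors n \<sigma> \<subseteq> first_letters w}"
    using K V by (intro image_eqI[of _ _ "target vs"]) auto
qed

text \<open>The first factor of a refinement of \<open>w\<close> corresponds to a nonempty set of cycles that can
  be moved to the front of \<open>w\<close>, hence to an arbitrary nonempty subset of the first letters
  of \<open>w\<close>, and the alternating sum over these subsets is \<open>-1\<close>.\<close>

lemma sum_refinements:
  assumes "w \<in> cycle_factorizations n"
  shows "(\<Sum>f \<in> {f \<in> proper_factorizations n. trace_eq w (refine n f)}. (-1) ^ length f)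
    = ((-1) ^ length w :: rat)"
  using assms
proof (induction w rule: measure_induct_rule[of length])
  case (less w)
  let ?A = "\<lambda>w. {f \<in> proper_factorizations n. trace_eq w (refine n f)}"
  let ?K = "cycle_factors n"
  let ?M = "first_letters w"
  have len: "length f \<le> length w" if "f \<in> ?A w" for f w
    using that trace_eq_length length_le_length_refine by fastforce
  have fin: "finite (?A w)" for w
    by (rule finite_subset[OF _ finite_proper_bounded[of n "length w"]]) (use len in blast)
  show ?case
  proof (cases "w = []")
    case True
    then have "?A w = {[]}"
      using len[of _ w] by (auto simp: proper_factorizations_def refine_def)
    with True show ?thesis by simp
  next
    case False
    define Sig where "Sig = {\<sigma>. \<sigma> permutes {1..n} \<and> \<sigma> \<noteq> id \<and> ?K \<sigma> \<subseteq> ?M}"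
    have "\<exists>u. trace_eq w (cycle_list n \<sigma> @ u)" if "\<sigma> \<in> Sig" for \<sigma>
      using that first_letters_prefix[OF distinct_cycle_list] by (simp add: Sig_def set_cycle_list)
    \<comment> \<open>\<open>u \<sigma>\<close> is what remains of \<open>w\<close> after the cycles
      of \<sigma>. Cancellation makes it unique up to \<open>trace_eq\<close>, so the choice does
      not matter.\<close>
    then obtain u where u: "trace_eq w (cycle_list n \<sigma> @ u \<sigma>)" if "\<sigma> \<in> Sig" for \<sigma> by metis
    \<comment> \<open>The factorizations over \<open>w\<close> split according to their first factor
      \<sigma>, the tails being those over \<open>u \<sigma>\<close>.\<close>
    have mem: "\<sigma> # f \<in> ?A w \<longleftrightarrow> \<sigma> \<in> Sig \<and> f \<in> ?A (u \<sigma>)" for \<sigma> f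
    proof -
      have iff: "trace_eq w (refine n (\<sigma> # f)) \<longleftrightarrow> trace_eq (u \<sigma>) (refine n f)" if "\<sigma> \<in> Sig"
      proof -
        have "trace_eq w (refine n (\<sigma> # f))
            \<longleftrightarrow> trace_eq (cycle_list n \<sigma> @ u \<sigma>) (refine n (\<sigma> # f))"
          using u[OF that] by (blast intro: rtranclp_trans trace_eq_sym)
        then show ?thesis by (simp add: refine_Cons trace_eq_cancel_left)
      qed
      have "\<sigma> \<in> Sig" if "\<sigma> # f \<in> ?A w"
      proof -
        have "trace_eq w (cycle_list n \<sigma> @ refine n f)" using that by (simp add: refine_Cons)
        then have "?K \<sigma> \<subseteq> ?M"
          using disjoint_list_prefix_first_letters[OF _ disjoint_list_cycle_list]
          by (simp add: set_cycle_list)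
        with that show ?thesis by (simp add: Sig_def proper_factorizations_alt)
      qed
      with iff show ?thesis by (auto simp: Sig_def proper_factorizations_alt)
    qed
    have Nil: "[] \<notin> ?A w" using False trace_eq_length[of w "[]"] by (auto simp: refine_def)
    have u_len: "length w = card (?K \<sigma>) + length (u \<sigma>)" if "\<sigma> \<in> Sig" for \<sigma>
      using trace_eq_length[OF u[OF that]] by (simp add: length_cycle_list)
    have bij: "bij_betw ?K Sig (Pow ?M - {{}})"
      unfolding Sig_def by (rule bij_betw_cycle_factors) (rule less.prems)
    have finM: "finite ?M" by (rule finite_subset[OF first_letters_subset]) simp
    then have finSig: "finite Sig" using bij_betw_finite[OF bij] by simp
    have IH: "(\<Sum>f\<in>?A (u \<sigma>). (-1) ^ length f) = ((-1) ^ length (u \<sigma>) :: rat)" if "\<sigma> \<in> Sig" for \<sigma>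
    proof (rule less.IH)
      have "?K \<sigma> \<noteq> {}" using bij_betwE[OF bij] that by blast
      then show "length (u \<sigma>) < length w"
        using u_len[OF that] finite_cycle_factors by (simp add: card_gt_0_iff)
      show "u \<sigma> \<in> cycle_factorizations n"
        using trace_eq_set[OF u[OF that]] less.prems by (auto simp: cycle_factorizations_def)
    qed
    \<comment> \<open>The minus sign accounts for the removed first factor.\<close>
    have "(\<Sum>f\<in>?A w. (-1) ^ length f)
        = (\<Sum>(\<sigma>, f)\<in>Sigma Sig (\<lambda>\<sigma>. ?A (u \<sigma>)). - ((-1) ^ length f) :: rat)"
    proof (rule sum.reindex_bij_witness[of _ "\<lambda>(\<sigma>, f). \<sigma> # f" "\<lambda>f. (hd f, tl f)"])
      fix f assume f: "f \<in> ?A w"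
      with Nil have "f \<noteq> []" by metis
      then have f_eq: "hd f # tl f = f" by simp
      then show "(case (hd f, tl f) of (\<sigma>, f) \<Rightarrow> \<sigma> # f) = f" by simp
      from f f_eq show "(hd f, tl f) \<in> Sigma Sig (\<lambda>\<sigma>. ?A (u \<sigma>))"
        using mem[of "hd f" "tl f"] by simp
      show "(case (hd f, tl f) of (\<sigma>, f) \<Rightarrow> - ((-1) ^ length f)) = ((-1) ^ length f :: rat)"
        by (subst (2) f_eq[symmetric]) (simp del: f_eq)
    next
      fix z assume "z \<in> Sigma Sig (\<lambda>\<sigma>. ?A (u \<sigma>))"
      then obtain \<sigma> f where z: "z = (\<sigma>, f)" "\<sigma> \<in> Sig" "f \<in> ?A (u \<sigma>)" by blast
      then show "(case z of (\<sigma>, f) \<Rightarrow> \<sigma> # f) \<in> ?A w" using mem[of \<sigma> f] by simp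
      from z show "(hd (case z of (\<sigma>, f) \<Rightarrow> \<sigma> # f), tl (case z of (\<sigma>, f) \<Rightarrow> \<sigma> # f)) = z" by simp
    qed
    also have "\<dots> = (\<Sum>\<sigma>\<in>Sig. \<Sum>f\<in>?A (u \<sigma>). - ((-1) ^ length f))"
      using finSig fin by (subst sum.Sigma) auto
    also have "\<dots> = (\<Sum>\<sigma>\<in>Sig. - ((-1) ^ length w) * (-1) ^ card (?K \<sigma>))"
    proof (rule sum.cong[OF refl])
      fix \<sigma> assume \<sigma>: "\<sigma> \<in> Sig"
      \<comment> \<open>\<open>card (?K \<sigma>)\<close> enters the exponent twice, so its sign
        cancels.\<close>
      have "(-1) ^ length w * (-1) ^ card (?K \<sigma>) = ((-1) ^ length (u \<sigma>) :: rat)"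
        unfolding u_len[OF \<sigma>] by (simp add: power_add mult.assoc power_mult_distrib[symmetric])
      then show "(\<Sum>f\<in>?A (u \<sigma>). - ((-1) ^ length f))
          = (- ((-1) ^ length w) * (-1) ^ card (?K \<sigma>) :: rat)"
        using IH[OF \<sigma>] by (simp add: sum_negf)
    qed
    also have "\<dots> = (\<Sum>V\<in>Pow ?M - {{}}. - ((-1) ^ length w) * (-1) ^ card V)"
      by (rule sum.reindex_bij_betw[OF bij])
    also have "\<dots> = - ((-1) ^ length w) * ((\<Sum>V\<in>Pow ?M. (-1) ^ card V) - 1)"
      using finM by (subst sum_distrib_left[symmetric]) (simp add: sum_diff1)
    \<comment> \<open>The leading letter of \<open>w\<close> makes \<open>?M\<close> nonempty. The
      full alternating sum then vanishes, and the missing empty set leaves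
      \<open>-1\<close>.\<close>
    also have "?M \<noteq> {}"
      using False by (cases w) (auto simp: first_letters_def)
    then have "- ((-1) ^ length w) * ((\<Sum>V\<in>Pow ?M. (-1) ^ card V) - 1) = ((-1) ^ length w :: rat)"
      using sum_Pow_alternating[OF finM, where 'a = rat] by simp
    finally show ?thesis .
  qed
qed

section \<open>The inverse series\<close>

lemma proper_term_alt: "proper_term n = (\<lambda>f. monomial (group_algebra (sym_group n))
    (scaled_elem ((-1) ^ length f) (target f)) (signature n f))"
  by (simp add: proper_term_def fun_eq_iff)

lemma proper_sum_apply:
  assumes "P \<subseteq> proper_factorizations n"
  shows "proper_sum n P b g = (\<Sum>f \<in> {f \<in> P. signature n f = b \<and> target f = g}. (-1) ^ length f)"
  unfolding proper_term_alt
proof (rule series_sum_monomials)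
  show "finite {f \<in> P. signature n f = b}" for b
    by (rule finite_subset[OF _ finite_proper_signature[of n b]]) (use assms in blast)
qed (use assms target_in_sym_group in auto)

lemma summable_proper_terms:
  "summable_family (group_algebra (sym_group n)) (proper_term n) (proper_factorizations n)"
  unfolding proper_term_alt
  by (rule summable_family_monomials) (simp_all add: finite_proper_signature)

lemma inequivalent_class:
  assumes "C \<in> inequivalent_factorizations n"
  obtains w where "w \<in> cycle_factorizations n" "C = swap_equiv n `` {w}"
  using assms unfolding inequivalent_factorizations_def by (rule quotientE)

lemma on_class_simps:
  assumes "w \<in> cycle_factorizations n"
  shows "on_class length (swap_equiv n `` {w}) = length w"
    "on_class target (swap_equiv n `` {w}) = target w"
    "on_class (signature n) (swap_equiv n `` {w}) = signature n w"
    "on_class (transitive_of_genus n g) (swap_equiv n `` {w}) = transitive_of_genus n g w"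
  by (rule on_class_eq[OF assms swap_equiv_invariant(1)]
        on_class_eq[OF assms swap_equiv_invariant(2)]
        on_class_eq[OF assms swap_equiv_invariant(3)]
        on_class_eq[OF assms swap_equiv_invariant(4)], assumption)+

lemma inequivalent_term_alt: "inequivalent_term n = (\<lambda>C. monomial (group_algebra (sym_group n))
    (scaled_elem ((-1) ^ on_class length C) (on_class target C)) (on_class (signature n) C))"
  by (simp add: inequivalent_term_def fun_eq_iff)

text \<open>Every class has a representative that is a proper factorization with the same
  signature.\<close>

lemma finite_inequivalent_signature:
  "finite {C \<in> inequivalent_factorizations n. on_class (signature n) C = b}"
proof (rule finite_subset)
  show "{C \<in> inequivalent_factorizations n. on_class (signature n) C = b}
      \<subseteq> (\<lambda>w. swap_equiv n `` {w}) ` {w \<in> proper_factorizations n. signature n w = b}"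
  proof
    fix C assume C: "C \<in> {C \<in> inequivalent_factorizations n. on_class (signature n) C = b}"
    then obtain w where "w \<in> cycle_factorizations n" "C = swap_equiv n `` {w}"
      using inequivalent_class by blast
    with C show "C \<in> (\<lambda>w. swap_equiv n `` {w}) ` {w \<in> proper_factorizations n. signature n w = b}"
      using cycle_factorizations_proper[of n] by (auto simp: on_class_simps)
  qed
qed (intro finite_imageI finite_proper_signature)

lemma inequivalent_sum_apply:
  assumes "I \<subseteq> inequivalent_factorizations n"
  shows "inequivalent_sum n I b g
    = (\<Sum>C \<in> {C \<in> I. on_class (signature n) C = b \<and> on_class target C = g}.
         (-1) ^ on_class length C)"
  unfolding inequivalent_term_alt
proof (rule series_sum_monomials)
  show "finite {C \<in> I. on_class (signature n) C = b}" for b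
    by (rule finite_subset[OF _ finite_inequivalent_signature[of n b]]) (use assms in blast)
  fix C assume "C \<in> I"
  with assms obtain w where "w \<in> cycle_factorizations n" "C = swap_equiv n `` {w}"
    using inequivalent_class by blast
  then show "on_class target C \<in> carrier (sym_group n)"
    using target_in_sym_group cycle_factorizations_proper by (auto simp: on_class_simps)
qed simp

lemma summable_inequivalent_terms:
  "summable_family (group_algebra (sym_group n)) (inequivalent_term n) (inequivalent_factorizations n)"
  unfolding inequivalent_term_alt
  by (rule summable_family_monomials) (simp_all add: finite_inequivalent_signature)

lemma swap_equiv_iff:
  "(f, f') \<in> swap_equiv n
    \<longleftrightarrow> f \<in> cycle_factorizations n \<and> f' \<in> cycle_factorizations n \<and> trace_eq f f'"
  by (simp add: swap_equiv_def)

text \<open>Proper factorizations are grouped by the class of their refinement. \<open>Q\<close> is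
  constantly true for the full sums and \<open>transitive_of_genus n g\<close> for the restricted
  ones.\<close>

lemma proper_sum_eq_inequivalent_sum:
  assumes refine: "\<And>f. f \<in> proper_factorizations n \<Longrightarrow> Q (refine n f) = Q f"
    and invariant: "\<And>f f'. (f, f') \<in> swap_equiv n \<Longrightarrow> Q f' = Q f"
  shows "proper_sum n {f \<in> proper_factorizations n. Q f}
    = inequivalent_sum n {C \<in> inequivalent_factorizations n. on_class Q C}"
proof (intro ext)
  fix b g
  let ?S = "{f \<in> {f \<in> proper_factorizations n. Q f}. signature n f = b \<and> target f = g}"
  let ?J = "{C \<in> {C \<in> inequivalent_factorizations n. on_class Q C}.
    on_class (signature n) C = b \<and> on_class target C = g}"
  let ?cls = "\<lambda>f. swap_equiv n `` {refine n f}"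
  have Q: "on_class Q (swap_equiv n `` {w}) = Q w" if "w \<in> cycle_factorizations n" for w
    by (rule on_class_eq[OF that invariant])
  have finS: "finite ?S"
    by (rule finite_subset[OF _ finite_proper_signature[of n b]]) blast
  have finJ: "finite ?J"
    by (rule finite_subset[OF _ finite_inequivalent_signature[of n b]]) blast
  have sub: "?cls ` ?S \<subseteq> ?J"
  proof
    fix C assume "C \<in> ?cls ` ?S"
    then obtain f where f: "f \<in> ?S" "C = ?cls f" by blast
    then have "f \<in> proper_factorizations n" by simp
    with f show "C \<in> ?J"
      using refine_in_cycle_factorizations[of n f]
      by (auto simp: inequivalent_factorizations_def quotientI on_class_simps Q refine
          target_refine signature_refine)
  qed
  have fibre: "(\<Sum>f\<in>{f \<in> ?S. ?cls f = C}. (-1) ^ length f) = ((-1) ^ on_class length C :: rat)"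
    if C: "C \<in> ?J" for C
  proof -
    obtain w where w: "w \<in> cycle_factorizations n" "C = swap_equiv n `` {w}"
      using C inequivalent_class by blast
    have props: "Q w" "signature n w = b" "target w = g"
      using C w by (simp_all add: Q on_class_simps)
    \<comment> \<open>Refinement and interchanges preserve signature, target and \<open>Q\<close>,
      so the conditions in \<open>?S\<close> hold automatically and the fibre is the one counted by
      \<open>sum_refinements\<close>.\<close>
    have "{f \<in> ?S. ?cls f = C} = {f \<in> proper_factorizations n. trace_eq w (refine n f)}"
    proof (rule Set.set_eqI)
      fix f
      have iff: "?cls f = C \<longleftrightarrow> (w, refine n f) \<in> swap_equiv n"
        unfolding w(2) eq_equiv_class_iff[OF swap_equiv_equiv refine_in_cycle_factorizations w(1)]
        using swap_equiv_equiv by (meson equivE symE)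
      have "f \<in> ?S" if "f \<in> proper_factorizations n" "(w, refine n f) \<in> swap_equiv n"
        using that props swap_equiv_invariant(2,3)[OF that(2)] invariant[OF that(2)]
        by (simp add: refine target_refine signature_refine)
      with iff show "f \<in> {f \<in> ?S. ?cls f = C}
          \<longleftrightarrow> f \<in> {f \<in> proper_factorizations n. trace_eq w (refine n f)}"
        using w(1) refine_in_cycle_factorizations[of n f] by (auto simp: swap_equiv_iff)
    qed
    with sum_refinements[OF w(1)] show ?thesis using w by (simp add: on_class_simps)
  qed
  have "proper_sum n {f \<in> proper_factorizations n. Q f} b g = (\<Sum>f\<in>?S. (-1) ^ length f)"
    by (rule proper_sum_apply) blast
  also have "\<dots> = (\<Sum>C\<in>?J. \<Sum>f\<in>{f \<in> ?S. ?cls f = C}. (-1) ^ length f)"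
    by (rule sum.group[OF finS finJ sub, symmetric])
  also have "\<dots> = (\<Sum>C\<in>?J. (-1) ^ on_class length C)"
    by (rule sum.cong[OF refl fibre])
  also have "\<dots> = inequivalent_sum n {C \<in> inequivalent_factorizations n. on_class Q C} b g"
    by (rule inequivalent_sum_apply[symmetric]) blast
  finally show "proper_sum n {f \<in> proper_factorizations n. Q f} b g
    = inequivalent_sum n {C \<in> inequivalent_factorizations n. on_class Q C} b g" .
qed

text \<open>The parameter \<open>J\<close> stands for adding a factor on the left or on the right.\<close>

lemma sum_extended_factorizations:
  assumes bij: "bij_betw (\<lambda>(h, f). J h f) ((carrier (sym_group n) - {id}) \<times> proper_factorizations n)
      (proper_factorizations n - {[]})"
    and len: "\<And>h f. length (J h f) = Suc (length f)"
    and sig: "\<And>h f. signature n (J h f) = perm_signature n h + signature n f"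
    and id: "\<And>f. target (J id f) = target f"
  shows "(\<Sum>(h, f) \<in> {(h, f). h \<in> carrier (sym_group n) \<and> f \<in> proper_factorizations n \<and>
      signature n (J h f) = b \<and> target (J h f) = g}. (-1) ^ length f)
    = (if b = {#} \<and> g = id then 1 else 0 :: rat)"
proof -
  let ?P = "{f \<in> proper_factorizations n. signature n f = b \<and> target f = g}"
  let ?Z1 = "{(h, f). h \<in> carrier (sym_group n) - {id} \<and> f \<in> proper_factorizations n \<and>
      signature n (J h f) = b \<and> target (J h f) = g}"
  \<comment> \<open>The case \<open>h = id\<close> contributes every member of \<open>?P\<close>
    with its own sign; the case \<open>h \<noteq> id\<close> contributes every nonempty member with
    the opposite sign, as \<open>J\<close> lengthens by one. Only the empty factorization
    survives.\<close>
  have Z: "{(h, f). h \<in> carrier (sym_group n) \<and> f \<in> proper_factorizations n \<and>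
      signature n (J h f) = b \<and> target (J h f) = g} = Pair id ` ?P \<union> ?Z1"
    using group.subgroup_self[OF sym_group_is_group, of n]
    by (auto simp: sig id perm_signature_id sym_group_carrier permutes_id)
  have "finite ?P"
    by (rule finite_subset[OF _ finite_proper_signature[of n b]]) blast
  have bij1: "bij_betw (\<lambda>(h, f). J h f) ?Z1 (?P - {[]})"
    unfolding bij_betw_def
  proof
    show "inj_on (\<lambda>(h, f). J h f) ?Z1"
      by (rule inj_on_subset[OF bij_betw_imp_inj_on[OF bij]]) auto
    show "(\<lambda>(h, f). J h f) ` ?Z1 = ?P - {[]}"
    proof (intro equalityI subsetI)
      fix f' assume "f' \<in> (\<lambda>(h, f). J h f) ` ?Z1"
      then obtain h f where hf: "f' = J h f" "(h, f) \<in> ?Z1" by auto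
      then have "J h f \<in> proper_factorizations n - {[]}"
        using bij_betw_apply[OF bij, of "(h, f)"] by simp
      with hf show "f' \<in> ?P - {[]}" by simp
    next
      fix f' assume f': "f' \<in> ?P - {[]}"
      then have "f' \<in> (\<lambda>(h, f). J h f) ` ((carrier (sym_group n) - {id}) \<times> proper_factorizations n)"
        using bij_betw_imp_surj_on[OF bij] by simp
      with f' show "f' \<in> (\<lambda>(h, f). J h f) ` ?Z1" by (auto simp: image_iff)
    qed
  qed
  then have "finite ?Z1" using \<open>finite ?P\<close> bij_betw_finite by blast
  have "(\<Sum>(h, f)\<in>?Z1. (-1) ^ length f) = (\<Sum>z\<in>?Z1. - ((-1) ^ length ((\<lambda>(h, f). J h f) z)) :: rat)"
    by (rule sum.cong) (auto simp: len)
  also have "\<dots> = (\<Sum>f\<in>?P - {[]}. - ((-1) ^ length f))"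
    by (rule sum.reindex_bij_betw[OF bij1])
  also have "\<dots> = (if [] \<in> ?P then 1 else 0) - (\<Sum>f\<in>?P. (-1) ^ length f)"
    using \<open>finite ?P\<close> by (simp add: sum_negf sum_diff1)
  finally have "(\<Sum>(h, f)\<in>?Z1. (-1) ^ length f)
      = (if [] \<in> ?P then 1 else 0) - (\<Sum>f\<in>?P. (-1) ^ length f :: rat)" .
  moreover have "(\<Sum>(h, f)\<in>Pair id ` ?P. (-1) ^ length f) = (\<Sum>f\<in>?P. (-1) ^ length f :: rat)"
    by (subst sum.reindex) (auto simp: inj_on_def)
  moreover have "Pair id ` ?P \<inter> ?Z1 = {}" by auto
  moreover have "[] \<in> ?P \<longleftrightarrow> b = {#} \<and> g = id"
    by (auto simp: proper_factorizations_def signature_def target_Nil)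
  ultimately show ?thesis
    unfolding Z using \<open>finite ?P\<close> \<open>finite ?Z1\<close> by (subst sum.union_disjoint) auto
qed

section \<open>The series of all permutations and its inverse\<close>

definition perm_series :: "nat \<Rightarrow> nat multiset \<Rightarrow> (nat \<Rightarrow> nat) \<Rightarrow> rat" where
  "perm_series n = (\<Oplus>\<^bsub>QSq n\<^esub>\<sigma> \<in> carrier (sym_group n). perm_term n \<sigma>)"

lemma set_perm_signature: "set_mset (perm_signature n \<sigma>) \<subseteq> {2..}"
  by (auto simp: perm_signature_def)

lemma set_signature: "set_mset (signature n f) \<subseteq> {2..}"
proof (induction f)
  case (Cons \<sigma> f)
  then show ?case using set_perm_signature[of n \<sigma>] by (simp add: signature_Cons)
qed (simp add: signature_def)

lemma perm_series_carrier: "perm_series n \<in> carrier (QSq n)"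
  and perm_series_apply: "perm_series n b g
    = (if g \<in> carrier (sym_group n) \<and> perm_signature n g = b then 1 else 0)"
proof -
  let ?t = "\<lambda>\<sigma>. monomial (group_algebra (sym_group n)) (scaled_elem 1 \<sigma>) (perm_signature n \<sigma>)"
  have eq: "perm_series n = (\<Oplus>\<^bsub>QSq n\<^esub>\<sigma> \<in> carrier (sym_group n). ?t \<sigma>)"
    unfolding perm_series_def perm_term_def ..
  show "perm_series n \<in> carrier (QSq n)"
    unfolding eq by (rule finsum_monomials(1)[OF finite_sym_group]) (simp_all add: set_perm_signature)
  have "perm_series n b g
      = (\<Sum>\<sigma> \<in> {\<sigma> \<in> carrier (sym_group n). perm_signature n \<sigma> = b \<and> \<sigma> = g}. 1)"
    unfolding eq
    by (rule finsum_monomials(2)[OF finite_sym_group]) (simp_all add: set_perm_signature)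
  also have "{\<sigma> \<in> carrier (sym_group n). perm_signature n \<sigma> = b \<and> \<sigma> = g}
      = (if g \<in> carrier (sym_group n) \<and> perm_signature n g = b then {g} else {})"
    by auto
  finally show "perm_series n b g
    = (if g \<in> carrier (sym_group n) \<and> perm_signature n g = b then 1 else 0)" by simp
qed

lemma proper_sum_carrier: "proper_sum n (proper_factorizations n) \<in> carrier (QSq n)"
proof -
  have "proper_sum n (proper_factorizations n) b g = 0"
    if "g \<notin> carrier (sym_group n) \<or> \<not> set_mset b \<subseteq> {2..}" for b g
  proof -
    have "{f \<in> proper_factorizations n. signature n f = b \<and> target f = g} = {}"
      using that target_in_sym_group set_signature by blast
    then show ?thesis by (simp only: proper_sum_apply[OF subset_refl] sum.empty)
  qed
  then have supp: "{g. proper_sum n (proper_factorizations n) b g \<noteq> 0} \<subseteq> carrier (sym_group n)"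
    and zero: "\<not> set_mset b \<subseteq> {2..} \<Longrightarrow> proper_sum n (proper_factorizations n) b
      = \<zero>\<^bsub>group_algebra (sym_group n)\<^esub>" for b
    by (blast, simp add: group_algebra_def fun_eq_iff)
  then show ?thesis
    using group_algebra_carrierI[OF finite_sym_group supp] by (simp add: mpower_series_def)
qed

lemma one_QSq_apply: "\<one>\<^bsub>QSq n\<^esub> b g = (if b = {#} \<and> g = id then 1 else 0)"
  by (auto simp: mpower_series_def group_algebra_def sym_group_one)

text \<open>A pair \<open>(h, f)\<close> stands for \<open>h # f\<close>, with \<open>h = id\<close>
  allowed. \<open>?\<psi>\<close> records the signatures and targets of both parts, and summing
  signs over its fibres gives the terms of the Cauchy product and the convolution.\<close>

lemma perm_series_mult_proper_sum:
  "perm_series n \<otimes>\<^bsub>QSq n\<^esub> proper_sum n (proper_factorizations n) = \<one>\<^bsub>QSq n\<^esub>"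
proof (intro ext)
  fix b g
  let ?S = "carrier (sym_group n)"
  let ?P = "proper_factorizations n"
  let ?Z = "{(h, f). h \<in> ?S \<and> f \<in> ?P \<and> signature n (h # f) = b \<and> target (h # f) = g}"
  let ?D = "{(c, d). c + d = b} \<times> {(h, k) \<in> ?S \<times> ?S. h \<otimes>\<^bsub>sym_group n\<^esub> k = g}"
  let ?\<psi> = "\<lambda>(h, f). ((perm_signature n h, signature n f), (h, target f))"
  have bij: "bij_betw (\<lambda>(h, f). h # f) ((?S - {id}) \<times> ?P) (?P - {[]})"
    by (rule bij_betwI[where g = "\<lambda>f. (hd f, tl f)"])
      (auto simp: proper_factorizations_def neq_Nil_conv dest: list.set_sel(2))
  have "finite ?D"
    using finite_multiset_splits[of b] finite_sym_group[of n]
    by (intro finite_cartesian_product) (auto intro: finite_subset[of _ "?S \<times> ?S"])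
  have "finite ?Z"
  proof (rule finite_subset)
    show "?Z \<subseteq> ?S \<times> {f \<in> ?P. length f \<le> size b}"
      using length_le_size_signature by (fastforce simp: signature_Cons)
  qed (simp add: finite_sym_group finite_proper_bounded)
  have sub: "?\<psi> ` ?Z \<subseteq> ?D"
    using target_in_sym_group
    by (auto simp: signature_Cons target_Cons sym_group_mult)
  have fibre: "(\<Sum>z\<in>{z \<in> ?Z. ?\<psi> z = p}. case z of (h, f) \<Rightarrow> (-1) ^ length f)
      = (\<lambda>((c, d), (h, k)). perm_series n c h * proper_sum n ?P d k) p" if "p \<in> ?D" for p
  proof -
    obtain c d h k where p: "p = ((c, d), (h, k))" by (metis prod.exhaust)
    with that have p': "c + d = b" "h \<in> ?S" "k \<in> ?S" "h \<circ> k = g" by (auto simp: sym_group_mult)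
    have "{z \<in> ?Z. ?\<psi> z = p} = (if perm_signature n h = c
        then Pair h ` {f \<in> ?P. signature n f = d \<and> target f = k} else {})"
      using p' by (auto simp: p signature_Cons target_Cons)
    then show ?thesis
      using p'(2)
      by (simp add: p perm_series_apply proper_sum_apply sum.reindex inj_on_def comp_def)
  qed
  have "(perm_series n \<otimes>\<^bsub>QSq n\<^esub> proper_sum n ?P) b g
      = (\<Sum>((c, d), (h, k))\<in>?D. perm_series n c h * proper_sum n ?P d k)"
    by (rule mpower_series_mult_finite[OF sym_group_is_group finite_sym_group
          perm_series_carrier proper_sum_carrier])
  also have "\<dots> = (\<Sum>p\<in>?D. \<Sum>z\<in>{z \<in> ?Z. ?\<psi> z = p}. case z of (h, f) \<Rightarrow> (-1) ^ length f)"
    by (rule sum.cong[OF refl fibre[symmetric]])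
  also have "\<dots> = (\<Sum>z\<in>?Z. case z of (h, f) \<Rightarrow> (-1) ^ length f)"
    by (rule sum.group[OF \<open>finite ?Z\<close> \<open>finite ?D\<close> sub])
  also have "\<dots> = \<one>\<^bsub>QSq n\<^esub> b g"
    unfolding one_QSq_apply
    by (rule sum_extended_factorizations[OF bij]) (simp_all add: signature_Cons target_Cons)
  finally show "(perm_series n \<otimes>\<^bsub>QSq n\<^esub> proper_sum n ?P) b g = \<one>\<^bsub>QSq n\<^esub> b g" .
qed

text \<open>The mirror image, with the factor appended on the right; \<open>?\<psi>\<close>
  therefore records the data of \<open>f\<close> before those of \<open>h\<close>.\<close>

lemma proper_sum_mult_perm_series:
  "proper_sum n (proper_factorizations n) \<otimes>\<^bsub>QSq n\<^esub> perm_series n = \<one>\<^bsub>QSq n\<^esub>"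
proof (intro ext)
  fix b g
  let ?S = "carrier (sym_group n)"
  let ?P = "proper_factorizations n"
  let ?Z = "{(h, f). h \<in> ?S \<and> f \<in> ?P \<and> signature n (f @ [h]) = b \<and> target (f @ [h]) = g}"
  let ?D = "{(c, d). c + d = b} \<times> {(h, k) \<in> ?S \<times> ?S. h \<otimes>\<^bsub>sym_group n\<^esub> k = g}"
  let ?\<psi> = "\<lambda>(h, f). ((signature n f, perm_signature n h), (target f, h))"
  have snoc: "signature n (f @ [h]) = perm_signature n h + signature n f"
    "target (f @ [h]) = target f \<circ> h" for f h
    by (simp_all add: signature_def target_append target_Cons target_Nil)
  have bij: "bij_betw (\<lambda>(h, f). f @ [h]) ((?S - {id}) \<times> ?P) (?P - {[]})"
    by (rule bij_betwI[where g = "\<lambda>f. (last f, butlast f)"])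
      (auto simp: proper_factorizations_def subset_iff dest: in_set_butlastD last_in_set)
  have "finite ?D"
    using finite_multiset_splits[of b] finite_sym_group[of n]
    by (intro finite_cartesian_product) (auto intro: finite_subset[of _ "?S \<times> ?S"])
  have "finite ?Z"
  proof (rule finite_subset)
    show "?Z \<subseteq> ?S \<times> {f \<in> ?P. length f \<le> size b}"
      using length_le_size_signature by (fastforce simp: snoc)
  qed (simp add: finite_sym_group finite_proper_bounded)
  have sub: "?\<psi> ` ?Z \<subseteq> ?D"
    using target_in_sym_group by (auto simp: snoc sym_group_mult add.commute)
  have fibre: "(\<Sum>z\<in>{z \<in> ?Z. ?\<psi> z = p}. case z of (h, f) \<Rightarrow> (-1) ^ length f)
      = (\<lambda>((c, d), (h, k)). proper_sum n ?P c h * perm_series n d k) p" if "p \<in> ?D" for p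
  proof -
    obtain c d h k where p: "p = ((c, d), (h, k))" by (metis prod.exhaust)
    with that have p': "c + d = b" "h \<in> ?S" "k \<in> ?S" "h \<circ> k = g" by (auto simp: sym_group_mult)
    have "{z \<in> ?Z. ?\<psi> z = p} = (if perm_signature n k = d
        then Pair k ` {f \<in> ?P. signature n f = c \<and> target f = h} else {})"
      using p' by (auto simp: p snoc add.commute)
    then show ?thesis
      using p'(3)
      by (simp add: p perm_series_apply proper_sum_apply sum.reindex inj_on_def comp_def)
  qed
  have "(proper_sum n ?P \<otimes>\<^bsub>QSq n\<^esub> perm_series n) b g
      = (\<Sum>((c, d), (h, k))\<in>?D. proper_sum n ?P c h * perm_series n d k)"
    by (rule mpower_series_mult_finite[OF sym_group_is_group finite_sym_group
          proper_sum_carrier perm_series_carrier])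
  also have "\<dots> = (\<Sum>p\<in>?D. \<Sum>z\<in>{z \<in> ?Z. ?\<psi> z = p}. case z of (h, f) \<Rightarrow> (-1) ^ length f)"
    by (rule sum.cong[OF refl fibre[symmetric]])
  also have "\<dots> = (\<Sum>z\<in>?Z. case z of (h, f) \<Rightarrow> (-1) ^ length f)"
    by (rule sum.group[OF \<open>finite ?Z\<close> \<open>finite ?D\<close> sub])
  also have "\<dots> = \<one>\<^bsub>QSq n\<^esub> b g"
    unfolding one_QSq_apply
    by (rule sum_extended_factorizations[OF bij]) (simp_all add: snoc)
  finally show "(proper_sum n ?P \<otimes>\<^bsub>QSq n\<^esub> perm_series n) b g = \<one>\<^bsub>QSq n\<^esub> b g" .
qed

lemma perm_series_unit: "perm_series n \<in> Units (QSq n)"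
  unfolding Units_def
  by (intro CollectI conjI bexI[of _ "proper_sum n (proper_factorizations n)"]
      perm_series_carrier proper_sum_carrier perm_series_mult_proper_sum proper_sum_mult_perm_series)

text \<open>\<open>m_inv\<close> is a definite description, so the inverse has to be unique: two
  right inverses of a series with constant coefficient 1 agree by left cancellation.\<close>

lemma inv_perm_series:
  "inv\<^bsub>QSq n\<^esub> (perm_series n) = proper_sum n (proper_factorizations n)"
  unfolding m_inv_def
proof (rule the_equality)
  fix y assume y: "y \<in> carrier (QSq n) \<and> perm_series n \<otimes>\<^bsub>QSq n\<^esub> y = \<one>\<^bsub>QSq n\<^esub>
    \<and> y \<otimes>\<^bsub>QSq n\<^esub> perm_series n = \<one>\<^bsub>QSq n\<^esub>"
  have "perm_series n {#} = \<one>\<^bsub>group_algebra (sym_group n)\<^esub>"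
    using perm_signature_eq_empty_iff perm_signature_id
    by (auto simp: fun_eq_iff[of "perm_series n {#}"] perm_series_apply group_algebra_def
        sym_group_one sym_group_carrier permutes_id)
  then show "y = proper_sum n (proper_factorizations n)"
    using y perm_series_mult_proper_sum
    by (intro mpower_series_group_algebra_left_cancel[OF sym_group_is_group
          perm_series_carrier _ proper_sum_carrier]) auto
qed (simp add: proper_sum_carrier perm_series_mult_proper_sum proper_sum_mult_perm_series)

theorem theorem3p1:
  fixes n :: nat
  shows "(\<Oplus>\<^bsub>QSq n\<^esub>\<sigma> \<in> carrier (sym_group n). perm_term n \<sigma>) \<in> Units (QSq n)
    \<and> summable_family (group_algebra (sym_group n)) (proper_term n) (proper_factorizations n)
    \<and> summable_family (group_algebra (sym_group n)) (inequivalent_term n)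
        (inequivalent_factorizations n)
    \<and> inv\<^bsub>QSq n\<^esub> (\<Oplus>\<^bsub>QSq n\<^esub>\<sigma> \<in> carrier (sym_group n). perm_term n \<sigma>)
        = proper_sum n (proper_factorizations n)
    \<and> proper_sum n (proper_factorizations n)
        = inequivalent_sum n (inequivalent_factorizations n)
    \<and> (\<forall>g :: nat.
         proper_sum n {f \<in> proper_factorizations n. transitive_of_genus n g f}
         = inequivalent_sum n
             {C \<in> inequivalent_factorizations n. on_class (transitive_of_genus n g) C})"
proof (intro conjI allI)
  \<comment> \<open>The full sums are the case of a constantly true \<open>Q\<close>, for which
    \<open>on_class\<close> selects every class.\<close>
  have "on_class (\<lambda>_. True) C" if "C \<in> inequivalent_factorizations n" for C
    using that by (rule inequivalent_class) (simp add: on_class_eq[where \<phi> = "\<lambda>_. True"])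
  then have "{C \<in> inequivalent_factorizations n. on_class (\<lambda>_. True) C}
      = inequivalent_factorizations n"
    by blast
  with proper_sum_eq_inequivalent_sum[of n "\<lambda>_. True"]
  show "proper_sum n (proper_factorizations n) = inequivalent_sum n (inequivalent_factorizations n)"
    by simp
  fix g
  show "proper_sum n {f \<in> proper_factorizations n. transitive_of_genus n g f}
    = inequivalent_sum n
        {C \<in> inequivalent_factorizations n. on_class (transitive_of_genus n g) C}"
    by (rule proper_sum_eq_inequivalent_sum)
      (rule transitive_of_genus_refine swap_equiv_invariant(4), assumption)+
qed (fold perm_series_def,
    (rule perm_series_unit summable_proper_terms summable_inequivalent_terms inv_perm_series)+)

end
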